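(* Let $G=(V,E)$ be a finite (not necessarily planar) graph, and let the coupling constants satisfy $J_e\ge0$, $U_e\le0$ and $\cosh(2J_e)\ge e^{-2U_e}$ for all $e\in E$. Let $S\subseteq V$ be a set of even cardinality. Then in the Ashkin--Teller model on $G$, $$\langle\sigma_S\rangle\le\sum_{\pi\in\Pi(S)}\prod_{uv\in\pi}\langle\sigma_u\sigma_v\rangle,$$ where $\Pi(S)$ is the set of all pairings of $S$, i.e. partitions of $S$ into sets of size two.
   Context: The Ashkin--Teller model (free boundary conditions) on a finite graph $G=(V,E)$ with real coupling constants $J_e,U_e$ is the probability measure on pairs $(\sigma,\tilde\sigma)\in\{-1,1\}^V\times\{-1,1\}^V$ given by $$\mathbf P(\sigma,\tilde\sigma)=\frac1{\mathcal Z}\prod_{uv\in E}\exp\big(J_{uv}(\sigma_u\sigma_v+\tilde\sigma_u\tilde\sigma_v)+U_{uv}(\sigma_u\sigma_v\tilde\sigma_u\tilde\sigma_v+1)\big),$$ with $\mathcal Z$ the normalizing constant; $\langle\cdot\rangle$ is the expectation. For $S\subseteq V$, $\sigma_S=\prod_{v\in S}\sigma_v$, with $\sigma_\emptyset=1$. *)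

theory Defs
  imports "HOL-Probability.Probability" "HOL-Library.Disjoint_Sets"
begin

text \<open>
  A finite simple graph is given by a finite vertex set \<open>V\<close> and a set \<open>E\<close> of two-element subsets
  of \<open>V\<close>; the coupling constants are functions on edges.  A spin configuration is a function that
  is \<open>undefined\<close> outside \<open>V\<close>, so that distinct elements of \<open>spins V\<close>
  differ at some vertex of \<open>V\<close>.
\<close>

definition spins :: "'a set \<Rightarrow> ('a \<Rightarrow> real) set" where
  "spins V = (V \<rightarrow>\<^sub>E {-1, 1})"

definition spin_prod :: "'a set \<Rightarrow> ('a \<Rightarrow> real) \<Rightarrow> real" where
  "spin_prod S \<sigma> = (\<Prod>v\<in>S. \<sigma> v)"

text \<open>For an edge \<open>e = {u, v}\<close> with \<open>u \<noteq> v\<close>, \<open>spin_prod e \<sigma>\<close> is \<open>\<sigma> u * \<sigma> v\<close>.\<close>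

lemma spin_prod_doubleton: "u \<noteq> v \<Longrightarrow> spin_prod {u, v} \<sigma> = \<sigma> u * \<sigma> v"
  by (simp add: spin_prod_def)

definition AT_weight ::
  "'a set set \<Rightarrow> ('a set \<Rightarrow> real) \<Rightarrow> ('a set \<Rightarrow> real) \<Rightarrow> ('a \<Rightarrow> real) \<times> ('a \<Rightarrow> real) \<Rightarrow> real" where
  "AT_weight E J U = (\<lambda>(\<sigma>, \<tau>). \<Prod>e\<in>E.
     exp (J e * (spin_prod e \<sigma> + spin_prod e \<tau>) + U e * (spin_prod e \<sigma> * spin_prod e \<tau> + 1)))"

definition AT_partition_function ::
  "'a set \<Rightarrow> 'a set set \<Rightarrow> ('a set \<Rightarrow> real) \<Rightarrow> ('a set \<Rightarrow> real) \<Rightarrow> real" where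
  "AT_partition_function V E J U = (\<Sum>\<omega>\<in>spins V \<times> spins V. AT_weight E J U \<omega>)"

definition AT_measure ::
  "'a set \<Rightarrow> 'a set set \<Rightarrow> ('a set \<Rightarrow> real) \<Rightarrow> ('a set \<Rightarrow> real) \<Rightarrow>
    (('a \<Rightarrow> real) \<times> ('a \<Rightarrow> real)) measure" where
  "AT_measure V E J U = point_measure (spins V \<times> spins V)
     (\<lambda>\<omega>. ennreal (AT_weight E J U \<omega> / AT_partition_function V E J U))"

definition AT_expectation ::
  "'a set \<Rightarrow> 'a set set \<Rightarrow> ('a set \<Rightarrow> real) \<Rightarrow> ('a set \<Rightarrow> real) \<Rightarrow>
    (('a \<Rightarrow> real) \<times> ('a \<Rightarrow> real) \<Rightarrow> real) \<Rightarrow> real" where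
  "AT_expectation V E J U f = (\<integral>\<omega>. f \<omega> \<partial>AT_measure V E J U)"

definition pairings :: "'a set \<Rightarrow> 'a set set set" where
  "pairings S = {\<pi>. partition_on S \<pi> \<and> (\<forall>p\<in>\<pi>. card p = 2)}"

lemma finite_spins: "finite V \<Longrightarrow> finite (spins V)"
  by (simp add: spins_def finite_PiE)

lemma spins_nonempty: "spins V \<noteq> {}"
  by (simp add: spins_def PiE_eq_empty_iff)

lemma AT_weight_pos: "AT_weight E J U \<omega> > 0"
  by (auto simp: AT_weight_def split: prod.split intro!: prod_pos)

lemma AT_partition_function_pos: "finite V \<Longrightarrow> AT_partition_function V E J U > 0"
  unfolding AT_partition_function_def
  by (intro sum_pos) (auto simp: finite_spins spins_nonempty AT_weight_pos)

lemma prob_space_AT_measure: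
  assumes "finite V"
  shows "prob_space (AT_measure V E J U)"
proof -
  let ?Z = "AT_partition_function V E J U"
  have Z: "?Z > 0" by (rule AT_partition_function_pos[OF assms])
  have "(\<Sum>\<omega>\<in>spins V \<times> spins V. ennreal (AT_weight E J U \<omega> / ?Z))
      = ennreal (\<Sum>\<omega>\<in>spins V \<times> spins V. AT_weight E J U \<omega> / ?Z)"
    using Z by (intro sum_ennreal) (simp add: less_imp_le[OF AT_weight_pos])
  also have "(\<Sum>\<omega>\<in>spins V \<times> spins V. AT_weight E J U \<omega> / ?Z) = ?Z / ?Z"
    unfolding AT_partition_function_def by (rule sum_divide_distrib[symmetric])
  also have "\<dots> = 1" using Z by simp
  finally have sum1: "(\<Sum>\<omega>\<in>spins V \<times> spins V. ennreal (AT_weight E J U \<omega> / ?Z)) = 1" by simp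
  show ?thesis
    unfolding AT_measure_def
    by (rule prob_spaceI)
      (simp add: space_point_measure emeasure_point_measure_finite finite_spins assms sum1)
qed

lemma AT_expectation_eq_sum:
  assumes "finite V"
  shows "AT_expectation V E J U f =
    (\<Sum>\<omega>\<in>spins V \<times> spins V. AT_weight E J U \<omega> / AT_partition_function V E J U * f \<omega>)"
  unfolding AT_expectation_def AT_measure_def
  by (subst lebesgue_integral_point_measure_finite)
    (auto simp: finite_spins assms less_imp_le[OF AT_weight_pos]
      less_imp_le[OF AT_partition_function_pos])

end

theory Submission
  imports Defs
begin

text \<open>
  Write \<open>(\<sigma>, \<tau>)\<close> for the two spins, \<open>X = (\<sigma> + \<tau>) / 2\<close> and \<open>Y = (\<sigma> - \<tau>) / 2\<close>.  The proof rests on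
  \<open>\<langle>\<sigma>\<^sub>A \<tau>\<^sub>D\<rangle> \<le> \<langle>\<sigma>\<^sub>A\<rangle> \<langle>\<tau>\<^sub>D\<rangle>\<close>, which uses \<open>U \<le> 0\<close>, and
  \<open>\<langle>X\<^sub>A Y\<^sub>D\<rangle> \<le> \<langle>X\<^sub>A\<rangle> \<langle>Y\<^sub>D\<rangle>\<close>, which uses \<open>cosh (2 J) \<ge> exp (- 2 U)\<close>.  Both follow from
  Ginibre's method: in two independent copies, fix part of the data at each vertex; the product of
  the two edge weights is then a polynomial with nonnegative coefficients in the remaining signs.

  Expanding \<open>\<sigma>\<^sub>S = \<Prod>(X + Y)\<close> bounds \<open>\<langle>\<sigma>\<^sub>S\<rangle>\<close> by products of moments of \<open>X\<close>, and expanding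
  \<open>X\<^sub>A = 2\<^bsup>-|A|\<^esup> \<Prod>(\<sigma> + \<tau>)\<close> bounds these by products of moments of \<open>\<sigma>\<close>.  For Gaussian moments both
  steps are equalities, so the Gaussian bound propagates by induction on the size of \<open>S\<close>.
\<close>

subsection \<open>A cone of functions of two configurations\<close>

type_synonym 'a conf = "('a \<Rightarrow> real) \<times> ('a \<Rightarrow> real)"

definition states :: "(real \<times> real) set" where
  "states = {-1, 1} \<times> {-1, 1}"

definition site :: "'a conf \<Rightarrow> 'a \<Rightarrow> real \<times> real" where
  "site \<omega> v = (fst \<omega> v, snd \<omega> v)"

abbreviation confs :: "'a set \<Rightarrow> 'a conf set" where
  "confs V \<equiv> spins V \<times> spins V"

lemma site_in_states: "\<omega> \<in> confs V \<Longrightarrow> v \<in> V \<Longrightarrow> site \<omega> v \<in> states"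
  by (auto simp: states_def site_def spins_def PiE_iff)

lemma sum_spins_prod:
  fixes g :: "'a \<Rightarrow> real \<Rightarrow> real"
  assumes "finite V"
  shows "(\<Sum>\<sigma>\<in>spins V. \<Prod>v\<in>V. g v (\<sigma> v)) = (\<Prod>v\<in>V. \<Sum>x\<in>{-1, 1}. g v x)"
  unfolding spins_def by (rule prod_sum_PiE[symmetric]) (use assms in auto)

lemma sum_confs_prod:
  fixes g :: "'a \<Rightarrow> real \<times> real \<Rightarrow> real"
  assumes "finite V"
  shows "(\<Sum>\<omega>\<in>confs V. \<Prod>v\<in>V. g v (site \<omega> v)) = (\<Prod>v\<in>V. \<Sum>z\<in>states. g v z)"
proof -
  have "(\<Sum>\<omega>\<in>confs V. \<Prod>v\<in>V. g v (site \<omega> v))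
      = (\<Sum>\<sigma>\<in>spins V. \<Sum>\<tau>\<in>spins V. \<Prod>v\<in>V. g v (\<sigma> v, \<tau> v))"
    by (simp add: sum.cartesian_product site_def case_prod_unfold)
  also have "\<dots> = (\<Sum>\<sigma>\<in>spins V. \<Prod>v\<in>V. \<Sum>y\<in>{-1, 1}. g v (\<sigma> v, y))"
  proof (rule sum.cong[OF refl])
    show "(\<Sum>\<tau>\<in>spins V. \<Prod>v\<in>V. g v (\<sigma> v, \<tau> v)) = (\<Prod>v\<in>V. \<Sum>y\<in>{-1, 1}. g v (\<sigma> v, y))" for \<sigma>
      by (rule sum_spins_prod[OF assms])
  qed
  also have "\<dots> = (\<Prod>v\<in>V. \<Sum>x\<in>{-1, 1}. \<Sum>y\<in>{-1, 1}. g v (x, y))"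
    by (rule sum_spins_prod[OF assms])
  also have "\<dots> = (\<Prod>v\<in>V. \<Sum>z\<in>states. g v z)"
    by (simp only: states_def sum.cartesian_product case_prod_unfold prod.collapse)
  finally show ?thesis .
qed

text \<open>Members of \<open>B\<close> depend on the states of two independent copies at one
  vertex. The last condition speaks of a single vertex; it passes to products over \<open>V\<close>
  because sums over configurations factorize.\<close>

locale site_cone =
  fixes B :: "(real \<times> real \<Rightarrow> real \<times> real \<Rightarrow> real) set"
  assumes one: "(\<lambda>_ _. 1) \<in> B"
    and mult: "b \<in> B \<Longrightarrow> c \<in> B \<Longrightarrow> (\<lambda>x y. b x y * c x y) \<in> B"
    and sum_states_nonneg: "b \<in> B \<Longrightarrow> 0 \<le> (\<Sum>x\<in>states. \<Sum>y\<in>states. b x y)"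
begin

text \<open>The clause \<open>eq_on_confs\<close> admits identities that hold only for spins equal
  to 1 or -1.\<close>

inductive cone :: "'a set \<Rightarrow> ('a conf \<Rightarrow> 'a conf \<Rightarrow> real) \<Rightarrow> bool" for V where
  base: "0 \<le> r \<Longrightarrow> (\<And>v. v \<in> V \<Longrightarrow> b v \<in> B) \<Longrightarrow>
    cone V (\<lambda>\<omega> \<omega>'. r * (\<Prod>v\<in>V. b v (site \<omega> v) (site \<omega>' v)))"
| add: "cone V F \<Longrightarrow> cone V G \<Longrightarrow> cone V (\<lambda>\<omega> \<omega>'. F \<omega> \<omega>' + G \<omega> \<omega>')"
| eq_on_confs: "cone V F \<Longrightarrow> (\<And>\<omega> \<omega>'. \<omega> \<in> confs V \<Longrightarrow> \<omega>' \<in> confs V \<Longrightarrow> F \<omega> \<omega>' = G \<omega> \<omega>') \<Longrightarrow> cone V G"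

lemma cone_const: "0 \<le> r \<Longrightarrow> cone V (\<lambda>_ _. r)"
  using base[of r V "\<lambda>_ _ _. 1"] one by simp

lemma cone_site:
  assumes "finite V" "v \<in> V" "b \<in> B"
  shows "cone V (\<lambda>\<omega> \<omega>'. b (site \<omega> v) (site \<omega>' v))"
proof (rule eq_on_confs)
  let ?b = "\<lambda>w. if w = v then b else (\<lambda>_ _. 1)"
  show "cone V (\<lambda>\<omega> \<omega>'. 1 * (\<Prod>w\<in>V. ?b w (site \<omega> w) (site \<omega>' w)))"
    by (rule base) (use assms one in auto)
  show "1 * (\<Prod>w\<in>V. ?b w (site \<omega> w) (site \<omega>' w)) = b (site \<omega> v) (site \<omega>' v)" for \<omega> \<omega>'
    using assms by (simp add: if_distribR prod.delta cong: if_cong)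
qed

lemma cone_mult:
  assumes F: "cone V F" and G: "cone V G"
  shows "cone V (\<lambda>\<omega> \<omega>'. F \<omega> \<omega>' * G \<omega> \<omega>')"
  using F
proof (induction rule: cone.induct)
  case (base r b)
  from G show ?case
  proof (induction rule: cone.induct)
    case (base r' b')
    have "cone V (\<lambda>\<omega> \<omega>'. (r * r') * (\<Prod>v\<in>V. b v (site \<omega> v) (site \<omega>' v) * b' v (site \<omega> v) (site \<omega>' v)))"
      by (rule cone.base[of _ _ "\<lambda>v x y. b v x y * b' v x y"])
        (use base \<open>0 \<le> r\<close> \<open>\<And>v. v \<in> V \<Longrightarrow> b v \<in> B\<close> mult in auto)
    then show ?case by (simp add: prod.distrib mult_ac)
  next
    case (add F G)
    then show ?case using cone.add[OF add.IH] by (simp add: algebra_simps)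
  next
    case (eq_on_confs F G)
    from eq_on_confs.IH show ?case by (rule cone.eq_on_confs) (simp add: eq_on_confs.hyps)
  qed
next
  case (add F G)
  then show ?case using cone.add[OF add.IH] by (simp add: algebra_simps)
next
  case (eq_on_confs F H)
  from eq_on_confs.IH show ?case by (rule cone.eq_on_confs) (simp add: eq_on_confs.hyps)
qed

lemma cone_sum:
  "finite I \<Longrightarrow> (\<And>i. i \<in> I \<Longrightarrow> cone V (F i)) \<Longrightarrow> cone V (\<lambda>\<omega> \<omega>'. \<Sum>i\<in>I. F i \<omega> \<omega>')"
  by (induction I rule: finite_induct) (auto intro: cone_const add)

lemma cone_prod:
  "finite I \<Longrightarrow> (\<And>i. i \<in> I \<Longrightarrow> cone V (F i)) \<Longrightarrow> cone V (\<lambda>\<omega> \<omega>'. \<Prod>i\<in>I. F i \<omega> \<omega>')"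
  by (induction I rule: finite_induct) (auto intro: cone_const cone_mult)

text \<open>On a generator, \<open>sum_confs_prod\<close>, applied once per copy, leaves a product
  over vertices of sums that are nonnegative by \<open>sum_states_nonneg\<close>.\<close>

lemma cone_sum_nonneg:
  assumes "finite V" "cone V F"
  shows "0 \<le> (\<Sum>\<omega>\<in>confs V. \<Sum>\<omega>'\<in>confs V. F \<omega> \<omega>')"
  using assms(2)
proof (induction rule: cone.induct)
  case (base r b)
  have "(\<Sum>\<omega>\<in>confs V. \<Sum>\<omega>'\<in>confs V. \<Prod>v\<in>V. b v (site \<omega> v) (site \<omega>' v))
      = (\<Sum>\<omega>\<in>confs V. \<Prod>v\<in>V. \<Sum>y\<in>states. b v (site \<omega> v) y)"
    by (intro sum.cong refl sum_confs_prod[where g = "\<lambda>v. b v (site _ v)"] assms)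
  also have "\<dots> = (\<Prod>v\<in>V. \<Sum>x\<in>states. \<Sum>y\<in>states. b v x y)"
    by (rule sum_confs_prod[OF assms(1)])
  also have "\<dots> \<ge> 0"
    by (intro prod_nonneg sum_states_nonneg base ballI)
  finally show ?case
    using base by (simp flip: sum_distrib_left)
next
  case (add F G)
  then show ?case by (simp add: sum.distrib)
next
  case (eq_on_confs F G)
  then show ?case by (simp cong: sum.cong)
qed

text \<open>With \<open>P = (\<Prod>(t + q))\<close> and \<open>M = (\<Prod>(t - q))\<close>, one factor maps \<open>P \<plusminus> M\<close> to
  \<open>t (P \<plusminus> M) + q (P \<mp> M)\<close>, so both signs are carried through the induction.\<close>

lemma cone_prod_add_diff:
  assumes "finite A" and t: "\<And>v. v \<in> A \<Longrightarrow> cone V (t v)" and q: "\<And>v. v \<in> A \<Longrightarrow> cone V (q v)"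
  shows "cone V (\<lambda>\<omega> \<omega>'. (\<Prod>v\<in>A. t v \<omega> \<omega>' + q v \<omega> \<omega>') + (\<Prod>v\<in>A. t v \<omega> \<omega>' - q v \<omega> \<omega>')) \<and>
    cone V (\<lambda>\<omega> \<omega>'. (\<Prod>v\<in>A. t v \<omega> \<omega>' + q v \<omega> \<omega>') - (\<Prod>v\<in>A. t v \<omega> \<omega>' - q v \<omega> \<omega>'))"
  using assms
proof (induction A rule: finite_induct)
  case empty
  show ?case by (simp add: cone_const)
next
  case (insert a A)
  let ?P = "\<lambda>\<omega> \<omega>'. \<Prod>v\<in>A. t v \<omega> \<omega>' + q v \<omega> \<omega>'" and ?M = "\<lambda>\<omega> \<omega>'. \<Prod>v\<in>A. t v \<omega> \<omega>' - q v \<omega> \<omega>'"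
  have IH: "cone V (\<lambda>\<omega> \<omega>'. ?P \<omega> \<omega>' + ?M \<omega> \<omega>')" "cone V (\<lambda>\<omega> \<omega>'. ?P \<omega> \<omega>' - ?M \<omega> \<omega>')"
    using insert by auto
  have plus_copy: "cone V (t a)" and qa: "cone V (q a)" using insert by auto
  from add[OF cone_mult[OF plus_copy IH(1)] cone_mult[OF qa IH(2)]]
    add[OF cone_mult[OF plus_copy IH(2)] cone_mult[OF qa IH(1)]]
  show ?case using insert.hyps by (simp add: algebra_simps)
qed

section \<open>Membership in the cone, checked on classes of pairs of states\<close>

lemma cone_if:
  "(P \<Longrightarrow> cone V F) \<Longrightarrow> (\<not> P \<Longrightarrow> cone V G) \<Longrightarrow> cone V (\<lambda>\<omega> \<omega>'. if P then F \<omega> \<omega>' else G \<omega> \<omega>')"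
  by (cases P) simp_all

text \<open>The class indicators at \<open>v\<close> form a partition of unity inside
  \<open>B\<close>, so each class may use its own representative of \<open>F\<close>.\<close>

lemma cone_split:
  assumes "finite V" "v \<in> V" "finite C"
    and "\<And>x y. x \<in> states \<Longrightarrow> y \<in> states \<Longrightarrow> cls x y \<in> C"
    and ind: "\<And>i. i \<in> C \<Longrightarrow> (\<lambda>x y. of_bool (cls x y = i)) \<in> B"
    and F: "\<And>i. i \<in> C \<Longrightarrow> \<exists>G. cone V G \<and> (\<forall>\<omega>\<in>confs V. \<forall>\<omega>'\<in>confs V.
        cls (site \<omega> v) (site \<omega>' v) = i \<longrightarrow> F \<omega> \<omega>' = G \<omega> \<omega>')"
  shows "cone V F"
proof -
  obtain G where G: "\<And>i. i \<in> C \<Longrightarrow> cone V (G i)"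
    "\<And>i \<omega> \<omega>'. i \<in> C \<Longrightarrow> \<omega> \<in> confs V \<Longrightarrow> \<omega>' \<in> confs V \<Longrightarrow>
        cls (site \<omega> v) (site \<omega>' v) = i \<Longrightarrow> F \<omega> \<omega>' = G i \<omega> \<omega>'"
    using F by metis
  show ?thesis
  proof (rule eq_on_confs)
    show "cone V (\<lambda>\<omega> \<omega>'. \<Sum>i\<in>C. of_bool (cls (site \<omega> v) (site \<omega>' v) = i) * G i \<omega> \<omega>')"
      using cone_site[OF assms(1,2) ind] by (intro cone_sum cone_mult G assms(3))
    fix \<omega> \<omega>' assume \<omega>: "\<omega> \<in> confs V" "\<omega>' \<in> confs V"
    let ?c = "cls (site \<omega> v) (site \<omega>' v)"
    have "?c \<in> C" using \<omega> assms(2,4) by (simp add: site_in_states)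
    have "(\<Sum>i\<in>C. of_bool (?c = i) * G i \<omega> \<omega>') = (\<Sum>i\<in>C. if i = ?c then G i \<omega> \<omega>' else 0)"
      by (intro sum.cong) auto
    also have "\<dots> = F \<omega> \<omega>'"
      using \<open>?c \<in> C\<close> assms(3) G(2)[OF _ \<omega> refl] by (simp add: sum.delta)
    finally show "(\<Sum>i\<in>C. of_bool (?c = i) * G i \<omega> \<omega>') = F \<omega> \<omega>'" .
  qed
qed

lemma cone_split2:
  assumes "finite V" "u \<in> V" "v \<in> V" "finite C"
    and "\<And>x y. x \<in> states \<Longrightarrow> y \<in> states \<Longrightarrow> cls x y \<in> C"
    and ind: "\<And>i. i \<in> C \<Longrightarrow> (\<lambda>x y. of_bool (cls x y = i)) \<in> B"
    and F: "\<And>i j. i \<in> C \<Longrightarrow> j \<in> C \<Longrightarrow> \<exists>G. cone V G \<and> (\<forall>\<omega>\<in>confs V. \<forall>\<omega>'\<in>confs V.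
        cls (site \<omega> u) (site \<omega>' u) = i \<longrightarrow> cls (site \<omega> v) (site \<omega>' v) = j \<longrightarrow> F \<omega> \<omega>' = G \<omega> \<omega>')"
  shows "cone V F"
proof (rule cone_split[OF assms(1,2,4,5) ind])
  fix i assume i: "i \<in> C"
  let ?I = "\<lambda>\<omega> \<omega>'. of_bool (cls (site \<omega> u) (site \<omega>' u) = i) :: real"
  have I: "cone V ?I" by (rule cone_site[OF assms(1,2) ind[OF i]])
  \<comment> \<open>The factor \<open>?I\<close> does not change \<open>F\<close> on the class
    \<open>i\<close> at \<open>u\<close>, and it makes the other classes at \<open>u\<close>
    harmless in the split at \<open>v\<close>.\<close>
  have "cone V (\<lambda>\<omega> \<omega>'. ?I \<omega> \<omega>' * F \<omega> \<omega>')"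
  proof (rule cone_split[OF assms(1,3,4,5) ind])
    fix j assume "j \<in> C"
    from F[OF i this] obtain G where G: "cone V G" "\<forall>\<omega>\<in>confs V. \<forall>\<omega>'\<in>confs V.
        cls (site \<omega> u) (site \<omega>' u) = i \<longrightarrow> cls (site \<omega> v) (site \<omega>' v) = j \<longrightarrow> F \<omega> \<omega>' = G \<omega> \<omega>'"
      by blast
    show "\<exists>G. cone V G \<and> (\<forall>\<omega>\<in>confs V. \<forall>\<omega>'\<in>confs V.
        cls (site \<omega> v) (site \<omega>' v) = j \<longrightarrow> ?I \<omega> \<omega>' * F \<omega> \<omega>' = G \<omega> \<omega>')"
      by (rule exI[of _ "\<lambda>\<omega> \<omega>'. ?I \<omega> \<omega>' * G \<omega> \<omega>'"]) (use cone_mult[OF I G(1)] G(2) in auto)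
  qed
  then show "\<exists>G. cone V G \<and> (\<forall>\<omega>\<in>confs V. \<forall>\<omega>'\<in>confs V.
      cls (site \<omega> u) (site \<omega>' u) = i \<longrightarrow> F \<omega> \<omega>' = G \<omega> \<omega>')"
    by (intro exI[of _ "\<lambda>\<omega> \<omega>'. ?I \<omega> \<omega>' * F \<omega> \<omega>'"]) auto
qed

text \<open>Ginibre's duplication: against \<open>W \<omega> * W \<omega>'\<close>, the product
  \<open>(f' \<omega> - f' \<omega>') * (g' \<omega>' - g' \<omega>)\<close> sums to twice the gap
  in \<open>sum_W_le\<close>. The reversed copies in the hypotheses on \<open>g\<close> make the
  correlation negative.\<close>

lemma
  fixes W :: "'a conf \<Rightarrow> real" and f g :: "real \<times> real \<Rightarrow> real"
  assumes V: "finite V" and sub: "A \<subseteq> V" "D \<subseteq> V"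
    and W: "cone V (\<lambda>\<omega> \<omega>'. W \<omega> * W \<omega>')"
    and f: "(\<lambda>x y. (f x + f y) / 2) \<in> B" "(\<lambda>x y. (f x - f y) / 2) \<in> B"
    and g: "(\<lambda>x y. (g y + g x) / 2) \<in> B" "(\<lambda>x y. (g y - g x) / 2) \<in> B"
  defines "f' \<equiv> \<lambda>\<omega>. \<Prod>v\<in>A. f (site \<omega> v)" and "g' \<equiv> \<lambda>\<omega>. \<Prod>v\<in>D. g (site \<omega> v)"
  shows sum_W_nonneg: "0 \<le> (\<Sum>\<omega>\<in>confs V. W \<omega> * f' \<omega>) * (\<Sum>\<omega>\<in>confs V. W \<omega>)"
    and sum_W_le: "(\<Sum>\<omega>\<in>confs V. W \<omega> * (f' \<omega> * g' \<omega>)) * (\<Sum>\<omega>\<in>confs V. W \<omega>)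
      \<le> (\<Sum>\<omega>\<in>confs V. W \<omega> * f' \<omega>) * (\<Sum>\<omega>\<in>confs V. W \<omega> * g' \<omega>)"
proof -
  have fin: "finite A" "finite D" using V sub finite_subset by auto
  note cA = cone_site[OF V subsetD[OF sub(1)]] and cD = cone_site[OF V subsetD[OF sub(2)]]
  have half: "(a + b) / 2 + (a - b) / 2 = a" "(a + b) / 2 - (a - b) / 2 = b" for a b :: real
    by (auto simp: field_simps)
  have f1: "cone V (\<lambda>\<omega> \<omega>'. f' \<omega> - f' \<omega>')" and f2: "cone V (\<lambda>\<omega> \<omega>'. f' \<omega>)"
  proof -
    \<comment> \<open>Half sum plus or minus half difference is the value of \<open>f\<close> in the
      first or second copy.\<close>
    show "cone V (\<lambda>\<omega> \<omega>'. f' \<omega> - f' \<omega>')"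
      using cone_prod_add_diff[OF fin(1),
          where t = "\<lambda>v \<omega> \<omega>'. (f (site \<omega> v) + f (site \<omega>' v)) / 2"
            and q = "\<lambda>v \<omega> \<omega>'. (f (site \<omega> v) - f (site \<omega>' v)) / 2"]
        cA[OF _ f(1)] cA[OF _ f(2)] by (simp add: f'_def half)
    have "cone V (\<lambda>\<omega> \<omega>'. f (site \<omega> v))" if "v \<in> A" for v
      using add[OF cA[OF that f(1)] cA[OF that f(2)]] by (simp add: half)
    then show "cone V (\<lambda>\<omega> \<omega>'. f' \<omega>)" unfolding f'_def by (intro cone_prod fin)
  qed
  have g1: "cone V (\<lambda>\<omega> \<omega>'. g' \<omega>' - g' \<omega>)"
    using cone_prod_add_diff[OF fin(2),
        where t = "\<lambda>v \<omega> \<omega>'. (g (site \<omega>' v) + g (site \<omega> v)) / 2"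
          and q = "\<lambda>v \<omega> \<omega>'. (g (site \<omega>' v) - g (site \<omega> v)) / 2"]
      cD[OF _ g(1)] cD[OF _ g(2)] by (simp add: g'_def half)
  let ?S = "\<lambda>h. \<Sum>\<omega>\<in>confs V. W \<omega> * h \<omega>"
  have S: "(\<Sum>\<omega>\<in>confs V. \<Sum>\<omega>'\<in>confs V. (W \<omega> * W \<omega>') * (h \<omega> * k \<omega>')) = ?S h * ?S k" for h k
    by (simp add: sum_product mult_ac)
  have "0 \<le> ?S f' * ?S (\<lambda>_. 1)"
    using cone_sum_nonneg[OF V cone_mult[OF W f2]] S[of f' "\<lambda>_. 1"] by simp
  then show "0 \<le> ?S f' * (\<Sum>\<omega>\<in>confs V. W \<omega>)" by simp
  have "0 \<le> (\<Sum>\<omega>\<in>confs V. \<Sum>\<omega>'\<in>confs V. (W \<omega> * W \<omega>') * ((f' \<omega> - f' \<omega>') * (g' \<omega>' - g' \<omega>)))"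
    by (intro cone_sum_nonneg V cone_mult W f1 g1)
  also have "\<dots> = (\<Sum>\<omega>\<in>confs V. \<Sum>\<omega>'\<in>confs V. (W \<omega> * W \<omega>') * (f' \<omega> * g' \<omega>')
      + (W \<omega> * W \<omega>') * (g' \<omega> * f' \<omega>') - (W \<omega> * W \<omega>') * ((f' \<omega> * g' \<omega>) * 1)
      - (W \<omega> * W \<omega>') * (1 * (f' \<omega>' * g' \<omega>')))"
    by (intro sum.cong refl) (simp add: algebra_simps)
  also have "\<dots> = 2 * (?S f' * ?S g' - ?S (\<lambda>\<omega>. f' \<omega> * g' \<omega>) * ?S (\<lambda>_. 1))"
    by (simp only: sum.distrib sum_subtractf S) (simp add: algebra_simps)
  finally show "?S (\<lambda>\<omega>. f' \<omega> * g' \<omega>) * (\<Sum>\<omega>\<in>confs V. W \<omega>) \<le> ?S f' * ?S g'" by simp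
qed

end

subsection \<open>The edge weight in the spins of the two layers\<close>

text \<open>The arguments \<open>a\<close> and \<open>b\<close> stand for the edge products of the
  two layers; any symmetric function of two signs has this form.\<close>

definition edge_poly :: "real \<Rightarrow> real \<Rightarrow> real \<Rightarrow> real \<Rightarrow> real \<Rightarrow> real" where
  "edge_poly c0 c1 c2 a b = c0 + c1 * (a + b) + c2 * (a * b)"

definition edge_val :: "real \<Rightarrow> real \<Rightarrow> real \<Rightarrow> real \<times> real \<Rightarrow> real \<times> real \<Rightarrow> real" where
  "edge_val c0 c1 c2 p q = edge_poly c0 c1 c2 (fst p * fst q) (snd p * snd q)"

lemma states_eq: "states = {(1, 1), (1, -1), (-1, 1), (-1, -1)}"
  by (auto simp: states_def)

lemma sum_states: "(\<Sum>x\<in>states. f x) = f (1, 1) + f (1, -1) + f (-1, 1) + f (-1, -1)" for f :: "_ \<Rightarrow> real"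
  by (simp add: states_eq add_ac)

lemma states_square: "x \<in> states \<Longrightarrow> (fst x)\<^sup>2 = 1" "x \<in> states \<Longrightarrow> (snd x)\<^sup>2 = 1"
  by (auto simp: states_eq)

text \<open>Here \<open>p\<close> and \<open>q\<close> are the states of the two copies at one vertex.  The data held fixed are the
  products of the copies in each layer.  Taking the free sign of the second layer from the second copy
  makes \<open>(\<tau>' - \<tau>) / 2\<close>, rather than \<open>(\<tau> - \<tau>') / 2\<close>, a positive function; this produces the sign
  of the correlation inequality.\<close>

definition layer_family :: "(real \<times> real \<Rightarrow> real \<times> real \<Rightarrow> real) set" where
  "layer_family = {b. \<exists>h k l. (\<forall>s t. 0 \<le> h s t) \<and> (\<forall>p\<in>states. \<forall>q\<in>states.
     b p q = h (fst p * fst q) (snd p * snd q) * fst p ^ k * snd q ^ l)}"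

lemma layer_familyI:
  assumes "\<And>s t. 0 \<le> h s t"
    and "\<And>p q. p \<in> states \<Longrightarrow> q \<in> states \<Longrightarrow> b p q = h (fst p * fst q) (snd p * snd q) * fst p ^ k * snd q ^ l"
  shows "b \<in> layer_family"
  using assms unfolding layer_family_def by blast

lemma minus_one_power_cases: "(-1) ^ k = (1::real) \<or> (-1) ^ k = (-1::real)"
  by (cases "even k") auto

text \<open>Under products the exponents add. A pair of states is determined by the two fixed
  products and the free signs \<open>fst p\<close> and \<open>snd q\<close>; a power of a free sign
  sums to 0 or 2.\<close>

interpretation layer: site_cone layer_family
proof
  show "(\<lambda>_ _. 1) \<in> layer_family" by (rule layer_familyI[of "\<lambda>_ _. 1" _ 0 0]) auto
next
  fix b c assume "b \<in> layer_family" "c \<in> layer_family"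
  then obtain h k l h' k' l' where
    "\<forall>s t. 0 \<le> h s t" "\<forall>p\<in>states. \<forall>q\<in>states. b p q = h (fst p * fst q) (snd p * snd q) * fst p ^ k * snd q ^ l"
    "\<forall>s t. 0 \<le> h' s t" "\<forall>p\<in>states. \<forall>q\<in>states. c p q = h' (fst p * fst q) (snd p * snd q) * fst p ^ k' * snd q ^ l'"
    unfolding layer_family_def by blast
  then show "(\<lambda>x y. b x y * c x y) \<in> layer_family"
    by (intro layer_familyI[of "\<lambda>s t. h s t * h' s t" _ "k + k'" "l + l'"]) (auto simp: power_add)
next
  fix b assume "b \<in> layer_family"
  then obtain h k l where h: "\<And>s t. 0 \<le> h s t"
    and b: "\<And>p q. p \<in> states \<Longrightarrow> q \<in> states \<Longrightarrow> b p q = h (fst p * fst q) (snd p * snd q) * fst p ^ k * snd q ^ l"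
    unfolding layer_family_def by blast
  have "(\<Sum>x\<in>states. \<Sum>y\<in>states. b x y)
      = (\<Sum>x\<in>states. \<Sum>y\<in>states. h (fst x * fst y) (snd x * snd y) * fst x ^ k * snd y ^ l)"
    by (intro sum.cong refl b)
  also have "\<dots> \<ge> 0"
    using minus_one_power_cases[of k] minus_one_power_cases[of l] h[of 1 1] h[of 1 "-1"] h[of "-1" 1] h[of "-1" "-1"]
    by (auto simp: sum_states)
  finally show "0 \<le> (\<Sum>x\<in>states. \<Sum>y\<in>states. b x y)" .
qed

text \<open>\<open>A\<close> is the edge product of the first layer in the first copy,
  \<open>D\<close> that of the second layer in the second copy; \<open>s\<close> and
  \<open>t\<close> convert them to the other copy.\<close>

lemma edge_poly_pair:
  assumes "s\<^sup>2 = 1" "t\<^sup>2 = 1" "A\<^sup>2 = 1" "D\<^sup>2 = 1"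
  shows "edge_poly c0 c1 c2 A (t * D) * edge_poly c0 c1 c2 (s * A) D =
    c0\<^sup>2 + c1\<^sup>2 * (s + t) + c2\<^sup>2 * (s * t) + c1 * (1 + s) * (c0 + c2 * t) * A
    + c1 * (1 + t) * (c0 + c2 * s) * D + (c0 * c2 * (s + t) + c1\<^sup>2 * (1 + s * t)) * (A * D)"
  using assms unfolding edge_poly_def by algebra

text \<open>Once the classes at both endpoints are fixed, \<open>s\<close> and \<open>t\<close> are
  constants and \<open>edge_poly_pair\<close> is a polynomial in the free signs. It remains to see
  that its four coefficients are nonnegative.\<close>

lemma layer_edge_cone:
  assumes c: "0 \<le> c1" "0 \<le> c2" "c2 \<le> c0" "2 * c1 \<le> c0 + c2" "c0 * c2 \<le> c1\<^sup>2"
    and V: "finite V" "u \<in> V" "v \<in> V"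
  shows "layer.cone V (\<lambda>\<omega> \<omega>'. edge_val c0 c1 c2 (site \<omega> u) (site \<omega> v) * edge_val c0 c1 c2 (site \<omega>' u) (site \<omega>' v))"
proof (rule layer.cone_split2[OF V, where C = states and cls = "\<lambda>p q. (fst p * fst q, snd p * snd q)"])
  show "finite states" by (simp add: states_def)
  show "(fst p * fst q, snd p * snd q) \<in> states" if "p \<in> states" "q \<in> states" for p q
    using that by (auto simp: states_def)
  show "(\<lambda>p q. of_bool ((fst p * fst q, snd p * snd q) = i)) \<in> layer_family" for i
    by (rule layer_familyI[of "\<lambda>s t. of_bool ((s, t) = i)" _ 0 0]) auto
next
  fix i j assume ij: "i \<in> states" "j \<in> states"
  define s t where st: "s = fst i * fst j" "t = snd i * snd j"
  have st': "s \<in> {-1, 1}" "t \<in> {-1, 1}" using ij by (auto simp: st states_def)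
  have st2: "s\<^sup>2 = 1" "t\<^sup>2 = 1" using st' by auto
  define k0 k1 k2 k3 where k: "k0 = c0\<^sup>2 + c1\<^sup>2 * (s + t) + c2\<^sup>2 * (s * t)"
    "k1 = c1 * (1 + s) * (c0 + c2 * t)" "k2 = c1 * (1 + t) * (c0 + c2 * s)"
    "k3 = c0 * c2 * (s + t) + c1\<^sup>2 * (1 + s * t)"
  \<comment> \<open>Adding the two squares settles \<open>k0\<close> for \<open>s = t = -1\<close>;
    opposite signs need \<open>c2\<^sup>2 \<le> c0\<^sup>2\<close>. The hypothesis
    \<open>c0 * c2 \<le> c1\<^sup>2\<close> enters in \<open>k3\<close> for
    \<open>s = t = -1\<close>.\<close>
  have "(2 * c1)\<^sup>2 \<le> (c0 + c2)\<^sup>2" using c by (intro power_mono) auto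
  moreover have "0 \<le> (c0 - c2)\<^sup>2" by simp
  ultimately have "0 \<le> c0\<^sup>2 + c2\<^sup>2 - 2 * c1\<^sup>2" by (simp add: power2_eq_square algebra_simps)
  moreover have "c2\<^sup>2 \<le> c0\<^sup>2" using c by (intro power_mono) auto
  moreover have "0 \<le> c0 * c2" using c by simp
  ultimately have nn: "0 \<le> k0" "0 \<le> k1" "0 \<le> k2" "0 \<le> k3"
    using st' c by (auto simp: k)
  let ?X = "\<lambda>w \<omega> (\<omega>' :: 'a conf). fst (site \<omega> w)" and ?Y = "\<lambda>w (\<omega> :: 'a conf) \<omega>'. snd (site \<omega>' w)"
  have X: "layer.cone V (?X w)" if "w \<in> V" for w
    by (rule layer.cone_site[OF V(1) that, of "\<lambda>p q. fst p"], rule layer_familyI[of "\<lambda>_ _. 1" _ 1 0]) auto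
  have Y: "layer.cone V (?Y w)" if "w \<in> V" for w
    by (rule layer.cone_site[OF V(1) that, of "\<lambda>p q. snd q"], rule layer_familyI[of "\<lambda>_ _. 1" _ 0 1]) auto
  let ?G = "\<lambda>\<omega> \<omega>'. k0 + k1 * (?X u \<omega> \<omega>' * ?X v \<omega> \<omega>') + k2 * (?Y u \<omega> \<omega>' * ?Y v \<omega> \<omega>')
     + k3 * ((?X u \<omega> \<omega>' * ?X v \<omega> \<omega>') * (?Y u \<omega> \<omega>' * ?Y v \<omega> \<omega>'))"
  have "layer.cone V ?G"
    by (intro layer.add layer.cone_mult layer.cone_const X Y nn V)
  moreover have "edge_val c0 c1 c2 p p' * edge_val c0 c1 c2 q q' =
      k0 + k1 * (fst p * fst p') + k2 * (snd q * snd q') + k3 * ((fst p * fst p') * (snd q * snd q'))"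
    if "p \<in> states" "p' \<in> states" "q \<in> states" "q' \<in> states"
      "i = (fst p * fst q, snd p * snd q)" "j = (fst p' * fst q', snd p' * snd q')" for p p' q q'
  proof -
    note sq = states_square
    have "snd p * snd p' * (snd q)\<^sup>2 * (snd q')\<^sup>2 = t * (snd q * snd q')"
      "fst q * fst q' * (fst p)\<^sup>2 * (fst p')\<^sup>2 = s * (fst p * fst p')"
      unfolding st that(5,6) by (simp_all add: power2_eq_square)
    then have eqs: "snd p * snd p' = t * (snd q * snd q')" "fst q * fst q' = s * (fst p * fst p')"
      by (simp_all only: sq that(1-4) mult_1_right)
    show ?thesis
      unfolding edge_val_def eqs k
      by (rule edge_poly_pair) (simp_all only: st2 sq that(1-4) power_mult_distrib mult_1_right)
  qed
  ultimately show "\<exists>G. layer.cone V G \<and> (\<forall>\<omega>\<in>confs V. \<forall>\<omega>'\<in>confs V.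
      (fst (site \<omega> u) * fst (site \<omega>' u), snd (site \<omega> u) * snd (site \<omega>' u)) = i \<longrightarrow>
      (fst (site \<omega> v) * fst (site \<omega>' v), snd (site \<omega> v) * snd (site \<omega>' v)) = j \<longrightarrow>
      edge_val c0 c1 c2 (site \<omega> u) (site \<omega> v) * edge_val c0 c1 c2 (site \<omega>' u) (site \<omega>' v) = G \<omega> \<omega>')"
    by (intro exI[of _ ?G] conjI ballI impI) (simp_all only: site_in_states V(2,3))
qed

subsection \<open>The edge weight in the rotated spins\<close>

lemma states_cases:
  assumes "p \<in> states"
  obtains "p = (1, 1)" | "p = (1, -1)" | "p = (-1, 1)" | "p = (-1, -1)"
  using assms by (auto simp: states_eq)

text \<open>A copy in state \<open>p\<close> has \<open>Y = 0\<close> if \<open>fst p * snd p = 1\<close> and \<open>X = 0\<close> otherwise.  If the copies are not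
  aligned, \<open>plus_spin\<close> is the nonzero \<open>X\<close> and \<open>minus_spin\<close> the nonzero \<open>Y\<close>.\<close>

definition aligned :: "real \<times> real \<Rightarrow> real \<times> real \<Rightarrow> bool" where
  "aligned p q \<longleftrightarrow> fst p * snd p = fst q * snd q"

definition plus_spin :: "real \<times> real \<Rightarrow> real \<times> real \<Rightarrow> real" where
  "plus_spin p q = (if fst p * snd p = 1 then fst p else fst q)"

definition minus_spin :: "real \<times> real \<Rightarrow> real \<times> real \<Rightarrow> real" where
  "minus_spin p q = (if fst p * snd p = 1 then fst q else fst p)"

section \<open>Edge products for the three patterns of alignment\<close>

lemmas state_pair_simps = aligned_def plus_spin_def minus_spin_def edge_val_def edge_poly_def

text \<open>In one copy, an edge whose ends agree in \<open>fst * snd\<close> has weight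
  \<open>c0 + c2\<close> plus \<open>2 * c1\<close> times the product of its first spins; otherwise
  the weight is \<open>c0 - c2\<close>. Here both copies are of the same kind.\<close>

lemma edge_aligned_aligned:
  assumes "p \<in> states" "p' \<in> states" "q \<in> states" "q' \<in> states"
    and "aligned p q" "aligned p' q'"
  shows "edge_val c0 c1 c2 p p' * edge_val c0 c1 c2 q q' =
    (if fst p * snd p = fst p' * snd p' then (c0 + c2)\<^sup>2 + (fst p * fst q) * (fst p' * fst q') * (2 * c1)\<^sup>2
       + (1 + (fst p * fst q) * (fst p' * fst q')) * ((c0 + c2) * (2 * c1)) * (plus_spin p q * plus_spin p' q')
     else (c0 - c2)\<^sup>2)"
  using assms
  by (elim states_cases; simp add: state_pair_simps; simp add: power2_eq_square algebra_simps)

text \<open>Exactly one copy has agreeing ends and contributes the spin term. The last sign corrects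
  for \<open>plus_spin p q\<close> being read from the other copy, which matters only if the first
  spins of \<open>p\<close> and \<open>q\<close> differ.\<close>

lemma edge_aligned_nonaligned:
  assumes "p \<in> states" "p' \<in> states" "q \<in> states" "q' \<in> states"
    and "aligned p q" "\<not> aligned p' q'"
  shows "edge_val c0 c1 c2 p p' * edge_val c0 c1 c2 q q' =
    (c0 - c2) * ((c0 + c2) + 2 * c1 * (plus_spin p q * (if fst p * snd p = 1 then plus_spin p' q' else minus_spin p' q')
      * (if fst p * fst q = 1 then 1 else fst p' * snd p')))"
  using assms
  by (elim states_cases; simp add: state_pair_simps; simp add: power2_eq_square algebra_simps)

text \<open>If the same copy carries X at both ends, each copy contributes a spin term; otherwise
  the product is \<open>(c0 - c2)\<^sup>2\<close>. The formula interpolates between these cases,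
  with \<open>2 * c0 * c2\<close> half the difference of \<open>(c0 + c2)\<^sup>2\<close> and
  \<open>(c0 - c2)\<^sup>2\<close>.\<close>

lemma edge_nonaligned_nonaligned:
  assumes "p \<in> states" "p' \<in> states" "q \<in> states" "q' \<in> states"
    and "\<not> aligned p q" "\<not> aligned p' q'"
  shows "edge_val c0 c1 c2 p p' * edge_val c0 c1 c2 q q' =
    ((c0 + c2)\<^sup>2 + (c0 - c2)\<^sup>2) / 2 + 2 * c0 * c2 * ((fst p * snd p) * (fst p' * snd p'))
    + 1 / 2 * (1 + (fst p * snd p) * (fst p' * snd p')) * ((c0 + c2) * (2 * c1) * (plus_spin p q * plus_spin p' q' + minus_spin p q * minus_spin p' q')
      + (2 * c1)\<^sup>2 * ((plus_spin p q * plus_spin p' q') * (minus_spin p q * minus_spin p' q')))"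
  using assms
  by (elim states_cases; simp add: state_pair_simps; simp add: power2_eq_square algebra_simps add_divide_distrib)

text \<open>An aligned pair has two fixed products and one free sign, a nonaligned pair three free
  signs. In aligned pairs with X = 0, \<open>plus_spin\<close> is read from the second copy, which
  puts \<open>(Y' - Y) / 2\<close> into the family.\<close>

definition rotated_family :: "(real \<times> real \<Rightarrow> real \<times> real \<Rightarrow> real) set" where
  "rotated_family = {b. \<exists>h k c l m n. (\<forall>s t. 0 \<le> h s t) \<and> 0 \<le> c \<and> (\<forall>p\<in>states. \<forall>q\<in>states.
     b p q = (if aligned p q then h (fst p * snd p) (fst p * fst q) * plus_spin p q ^ k
              else c * (fst p * snd p) ^ l * plus_spin p q ^ m * minus_spin p q ^ n))}"

lemma rotated_familyI:
  assumes "\<And>s t. 0 \<le> h s t" "0 \<le> c"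
    and "\<And>p q. p \<in> states \<Longrightarrow> q \<in> states \<Longrightarrow> aligned p q \<Longrightarrow>
      b p q = h (fst p * snd p) (fst p * fst q) * plus_spin p q ^ k"
    and "\<And>p q. p \<in> states \<Longrightarrow> q \<in> states \<Longrightarrow> \<not> aligned p q \<Longrightarrow>
      b p q = c * (fst p * snd p) ^ l * plus_spin p q ^ m * minus_spin p q ^ n"
  shows "b \<in> rotated_family"
  unfolding rotated_family_def using assms by (intro CollectI exI[of _ h] exI[of _ k] exI[of _ c] exI[of _ l]
    exI[of _ m] exI[of _ n]) auto

interpretation rotated: site_cone rotated_family
proof
  show "(\<lambda>_ _. 1) \<in> rotated_family" by (rule rotated_familyI[of "\<lambda>_ _. 1" 1 _ 0 0 0 0]) auto
next
  fix b b' assume "b \<in> rotated_family" "b' \<in> rotated_family"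
  then obtain h k c l m n h' k' c' l' m' n' where
    "\<forall>s t. 0 \<le> h s t" "0 \<le> c" "\<forall>p\<in>states. \<forall>q\<in>states.
     b p q = (if aligned p q then h (fst p * snd p) (fst p * fst q) * plus_spin p q ^ k
              else c * (fst p * snd p) ^ l * plus_spin p q ^ m * minus_spin p q ^ n)"
    "\<forall>s t. 0 \<le> h' s t" "0 \<le> c'" "\<forall>p\<in>states. \<forall>q\<in>states.
     b' p q = (if aligned p q then h' (fst p * snd p) (fst p * fst q) * plus_spin p q ^ k'
              else c' * (fst p * snd p) ^ l' * plus_spin p q ^ m' * minus_spin p q ^ n')"
    unfolding rotated_family_def by blast
  then show "(\<lambda>x y. b x y * b' x y) \<in> rotated_family"
    by (intro rotated_familyI[of "\<lambda>s t. h s t * h' s t" "c * c'" _ "k + k'" "l + l'" "m + m'" "n + n'"])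
      (auto simp: power_add)
next
  fix b assume "b \<in> rotated_family"
  then obtain h k c l m n where h: "\<And>s t. 0 \<le> h s t" and c: "0 \<le> c"
    and b: "\<And>p q. p \<in> states \<Longrightarrow> q \<in> states \<Longrightarrow>
     b p q = (if aligned p q then h (fst p * snd p) (fst p * fst q) * plus_spin p q ^ k
              else c * (fst p * snd p) ^ l * plus_spin p q ^ m * minus_spin p q ^ n)"
    unfolding rotated_family_def by blast
  have "(\<Sum>x\<in>states. \<Sum>y\<in>states. b x y)
      = (\<Sum>p\<in>states. \<Sum>q\<in>states. if aligned p q then h (fst p * snd p) (fst p * fst q) * plus_spin p q ^ k
              else c * (fst p * snd p) ^ l * plus_spin p q ^ m * minus_spin p q ^ n)"
    by (intro sum.cong refl b)
  also have "\<dots> \<ge> 0"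
    using minus_one_power_cases[of k] minus_one_power_cases[of l] minus_one_power_cases[of m]
      minus_one_power_cases[of n] h[of 1 1] h[of 1 "-1"] h[of "-1" 1] h[of "-1" "-1"] c
    by (elim disjE; simp add: sum_states state_pair_simps)
  finally show "0 \<le> (\<Sum>x\<in>states. \<Sum>y\<in>states. b x y)" .
qed

text \<open>On nonaligned pairs this is 1 if the first copy carries X and -1 if the second does; 1
  is a default on aligned pairs.\<close>

definition plus_copy :: "real \<times> real \<Rightarrow> real \<times> real \<Rightarrow> real" where
  "plus_copy p q = (if aligned p q then 1 else fst p * snd p)"

definition minus_spin' :: "real \<times> real \<Rightarrow> real \<times> real \<Rightarrow> real" where
  "minus_spin' p q = (if aligned p q then 1 else minus_spin p q)"

lemma rotated_family_characters: "plus_spin \<in> rotated_family" "plus_copy \<in> rotated_family" "minus_spin' \<in> rotated_family"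
  by (rule rotated_familyI[of "\<lambda>_ _. 1" 1 _ 1 0 1 0] rotated_familyI[of "\<lambda>_ _. 1" 1 _ 0 1 0 0] rotated_familyI[of "\<lambda>_ _. 1" 1 _ 0 0 0 1];
      simp add: plus_copy_def minus_spin'_def)+

text \<open>Nonaligned pairs form the single class \<open>None\<close>, since all three of their
  signs stay free.\<close>

definition pair_class :: "real \<times> real \<Rightarrow> real \<times> real \<Rightarrow> (real \<times> real) option" where
  "pair_class p q = (if aligned p q then Some (fst p * snd p, fst p * fst q) else None)"

text \<open>Serves both mixed patterns, the second after exchanging \<open>u\<close> and
  \<open>v\<close>. On a class \<open>t\<close> and \<open>s\<close> are constants, so the
  conditions in \<open>?G\<close> do not depend on the configurations.\<close>

lemma rotated_edge_cone_aligned_nonaligned: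
  assumes c: "0 \<le> c1" "0 \<le> c2" "c2 \<le> c0" "2 * c1 \<le> c0 + c2"
    and V: "finite V" "u \<in> V" "v \<in> V"
    and i: "i = Some (t, s)" "(t, s) \<in> states"
  shows "\<exists>G. rotated.cone V G \<and> (\<forall>\<omega>\<in>confs V. \<forall>\<omega>'\<in>confs V.
     pair_class (site \<omega> u) (site \<omega>' u) = i \<longrightarrow> pair_class (site \<omega> v) (site \<omega>' v) = None \<longrightarrow>
     edge_val c0 c1 c2 (site \<omega> u) (site \<omega> v) * edge_val c0 c1 c2 (site \<omega>' u) (site \<omega>' v) = G \<omega> \<omega>')"
proof -
  note char = rotated.cone_site[OF V(1) _ rotated_family_characters(1)] rotated.cone_site[OF V(1) _ rotated_family_characters(2)]
    rotated.cone_site[OF V(1) _ rotated_family_characters(3)]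
  let ?A = "\<lambda>w \<omega> \<omega>'. plus_spin (site \<omega> w) (site \<omega>' w)" and ?T = "\<lambda>w \<omega> \<omega>'. plus_copy (site \<omega> w) (site \<omega>' w)"
    and ?B = "\<lambda>w \<omega> \<omega>'. minus_spin' (site \<omega> w) (site \<omega>' w)"
  define d g y where dgy: "d = c0 - c2" "g = c0 + c2" "y = 2 * c1"
  have nn: "0 \<le> d" "0 \<le> g" "0 \<le> y" using c by (auto simp: dgy)
  let ?G = "\<lambda>\<omega> \<omega>'. d * (g + y * (?A u \<omega> \<omega>' * (if t = 1 then ?A v \<omega> \<omega>' else ?B v \<omega> \<omega>')
      * (if s = 1 then 1 else ?T v \<omega> \<omega>')))"
  show ?thesis
  proof (intro exI[of _ ?G] conjI ballI impI)
    show "rotated.cone V ?G"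
      using V nn by (intro rotated.cone_if rotated.add rotated.cone_mult rotated.cone_const char; simp)
  next
    fix \<omega> \<omega>' :: "'a conf"
    assume \<omega>: "\<omega> \<in> confs V" "\<omega>' \<in> confs V"
      and cls: "pair_class (site \<omega> u) (site \<omega>' u) = i" "pair_class (site \<omega> v) (site \<omega>' v) = None"
    from cls i have a: "aligned (site \<omega> u) (site \<omega>' u)" "\<not> aligned (site \<omega> v) (site \<omega>' v)"
        "fst (site \<omega> u) * snd (site \<omega> u) = t" "fst (site \<omega> u) * fst (site \<omega>' u) = s"
      by (auto simp: pair_class_def split: if_splits)
    note st = site_in_states[OF \<omega>(1) V(2)] site_in_states[OF \<omega>(1) V(3)]
      site_in_states[OF \<omega>(2) V(2)] site_in_states[OF \<omega>(2) V(3)]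
    show "edge_val c0 c1 c2 (site \<omega> u) (site \<omega> v) * edge_val c0 c1 c2 (site \<omega>' u) (site \<omega>' v) = ?G \<omega> \<omega>'"
      unfolding edge_aligned_nonaligned[OF st a(1,2)] a(3,4) using a(2) by (simp add: plus_copy_def minus_spin'_def dgy)
  qed
qed

lemma edge_val_commute: "edge_val c0 c1 c2 p q = edge_val c0 c1 c2 q p"
  by (simp add: edge_val_def mult.commute)

lemma rotated_edge_cone:
  assumes c: "0 \<le> c1" "0 \<le> c2" "c2 \<le> c0" "2 * c1 \<le> c0 + c2"
    and V: "finite V" "u \<in> V" "v \<in> V"
  shows "rotated.cone V (\<lambda>\<omega> \<omega>'. edge_val c0 c1 c2 (site \<omega> u) (site \<omega> v) * edge_val c0 c1 c2 (site \<omega>' u) (site \<omega>' v))"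
    (is "rotated.cone V ?F")
proof (rule rotated.cone_split2[OF V, where C = "insert None (Some ` states)" and cls = pair_class])
  show "finite (insert None (Some ` states))" by (simp add: states_def)
  show "pair_class p q \<in> insert None (Some ` states)" if "p \<in> states" "q \<in> states" for p q
    using that by (auto simp: states_def pair_class_def)
  show "(\<lambda>p q. of_bool (pair_class p q = i)) \<in> rotated_family" for i
    by (rule rotated_familyI[of "\<lambda>s t. of_bool (Some (s, t) = i)" "of_bool (None = i)" _ 0 0 0 0]) (auto simp: pair_class_def)
next
  fix i j assume ij: "i \<in> insert None (Some ` states)" "j \<in> insert None (Some ` states)"
  note char = rotated.cone_site[OF V(1) _ rotated_family_characters(1)] rotated.cone_site[OF V(1) _ rotated_family_characters(2)]
    rotated.cone_site[OF V(1) _ rotated_family_characters(3)]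
  let ?A = "\<lambda>w \<omega> \<omega>'. plus_spin (site \<omega> w) (site \<omega>' w)" and ?T = "\<lambda>w \<omega> \<omega>'. plus_copy (site \<omega> w) (site \<omega>' w)"
    and ?B = "\<lambda>w \<omega> \<omega>'. minus_spin' (site \<omega> w) (site \<omega>' w)"
  note st = site_in_states[OF _ V(2)] site_in_states[OF _ V(3)]
  have y: "(2 * c1)\<^sup>2 \<le> (c0 + c2)\<^sup>2" using c by (intro power_mono) auto
  let ?thesis = "\<exists>G. rotated.cone V G \<and> (\<forall>\<omega>\<in>confs V. \<forall>\<omega>'\<in>confs V.
      pair_class (site \<omega> u) (site \<omega>' u) = i \<longrightarrow> pair_class (site \<omega> v) (site \<omega>' v) = j \<longrightarrow> ?F \<omega> \<omega>' = G \<omega> \<omega>')"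
  consider t s t' s' where "i = Some (t, s)" "j = Some (t', s')" "(t, s) \<in> states" "(t', s') \<in> states"
    | t s where "i = Some (t, s)" "j = None" "(t, s) \<in> states"
    | t s where "i = None" "j = Some (t, s)" "(t, s) \<in> states"
    | "i = None" "j = None"
    using ij by fastforce
  then show ?thesis
  proof cases
    case 1
    define k0 k1 k2 where k: "k0 = (c0 + c2)\<^sup>2 + s * s' * (2 * c1)\<^sup>2"
      "k1 = (1 + s * s') * ((c0 + c2) * (2 * c1))" "k2 = (c0 - c2)\<^sup>2"
    let ?G = "\<lambda>\<omega> \<omega>'. if t = t' then k0 + k1 * (?A u \<omega> \<omega>' * ?A v \<omega> \<omega>') else k2"
    \<comment> \<open>For the value -1, \<open>k0\<close> is a difference of squares, nonnegative by
      \<open>y\<close>.\<close>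
    have "s * s' = 1 \<or> s * s' = -1" using 1 by (auto simp: states_def)
    then have nn: "0 \<le> k0" "0 \<le> k1" "0 \<le> k2"
      using y c by (auto simp: k)
    show ?thesis
    proof (intro exI[of _ ?G] conjI ballI impI)
      show "rotated.cone V ?G"
        by (intro rotated.cone_if rotated.add rotated.cone_mult rotated.cone_const char nn V)
      fix \<omega> \<omega>' :: "'a conf"
      assume \<omega>: "\<omega> \<in> confs V" "\<omega>' \<in> confs V"
        and cls: "pair_class (site \<omega> u) (site \<omega>' u) = i" "pair_class (site \<omega> v) (site \<omega>' v) = j"
      from cls 1 have a: "aligned (site \<omega> u) (site \<omega>' u)" "aligned (site \<omega> v) (site \<omega>' v)"
        "fst (site \<omega> u) * snd (site \<omega> u) = t" "fst (site \<omega> u) * fst (site \<omega>' u) = s"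
        "fst (site \<omega> v) * snd (site \<omega> v) = t'" "fst (site \<omega> v) * fst (site \<omega>' v) = s'"
        by (auto simp: pair_class_def split: if_splits)
      show "?F \<omega> \<omega>' = ?G \<omega> \<omega>'"
        unfolding edge_aligned_aligned[OF st[OF \<omega>(1)] st[OF \<omega>(2)] a(1,2)] a(3-6) k by simp
    qed
  next
    case 2
    show ?thesis
      using rotated_edge_cone_aligned_nonaligned[OF c V 2(1,3)] unfolding 2(2) by blast
  next
    case 3
    show ?thesis
      using rotated_edge_cone_aligned_nonaligned[OF c V(1,3,2) 3(2,3)] unfolding 3(1)
      by (subst (1 2) edge_val_commute) blast
  next
    case 4
    define k0 k1 k2 k3 where k: "k0 = ((c0 + c2)\<^sup>2 + (c0 - c2)\<^sup>2) / 2" "k1 = 2 * c0 * c2"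
      "k2 = (c0 + c2) * (2 * c1)" "k3 = (2 * c1)\<^sup>2"
    let ?G = "\<lambda>\<omega> \<omega>'. k0 + k1 * (?T u \<omega> \<omega>' * ?T v \<omega> \<omega>')
      + 1 / 2 * (1 + ?T u \<omega> \<omega>' * ?T v \<omega> \<omega>') * (k2 * (?A u \<omega> \<omega>' * ?A v \<omega> \<omega>' + ?B u \<omega> \<omega>' * ?B v \<omega> \<omega>')
        + k3 * ((?A u \<omega> \<omega>' * ?A v \<omega> \<omega>') * (?B u \<omega> \<omega>' * ?B v \<omega> \<omega>')))"
    have nn: "0 \<le> k0" "0 \<le> k1" "0 \<le> k2" "0 \<le> k3"
      using c by (auto simp: k)
    show ?thesis
    proof (intro exI[of _ ?G] conjI ballI impI)
      show "rotated.cone V ?G"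
        by (intro rotated.add rotated.cone_mult rotated.cone_const char V nn; simp)
      fix \<omega> \<omega>' :: "'a conf"
      assume \<omega>: "\<omega> \<in> confs V" "\<omega>' \<in> confs V"
        and cls: "pair_class (site \<omega> u) (site \<omega>' u) = i" "pair_class (site \<omega> v) (site \<omega>' v) = j"
      from cls 4 have a: "\<not> aligned (site \<omega> u) (site \<omega>' u)" "\<not> aligned (site \<omega> v) (site \<omega>' v)"
        by (auto simp: pair_class_def split: if_splits)
      show "?F \<omega> \<omega>' = ?G \<omega> \<omega>'"
        unfolding edge_nonaligned_nonaligned[OF st[OF \<omega>(1)] st[OF \<omega>(2)] a]
        using a by (simp add: plus_copy_def minus_spin'_def k)
    qed
  qed
qed

subsection \<open>Sums over pairings\<close>

text \<open>Wick's formula: the moment over \<open>S\<close> of a centred Gaussian vector with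
  covariances \<open>g\<close>.\<close>

definition pairing_sum :: "('a set \<Rightarrow> real) \<Rightarrow> 'a set \<Rightarrow> real" where
  "pairing_sum g S = (\<Sum>\<pi>\<in>pairings S. \<Prod>p\<in>\<pi>. g p)"

lemma finite_pairings: "finite S \<Longrightarrow> finite (pairings S)"
  by (rule finite_subset[of _ "Pow (Pow S)"]) (auto simp: pairings_def partition_on_def)

lemma finite_pairing: "finite S \<Longrightarrow> \<pi> \<in> pairings S \<Longrightarrow> finite \<pi>"
  by (rule finite_subset[of _ "Pow S"]) (auto simp: pairings_def partition_on_def)

lemma card_pairing:
  assumes "finite S" "\<pi> \<in> pairings S"
  shows "card S = 2 * card \<pi>"
proof -
  have "card S = (\<Sum>p\<in>\<pi>. card p)"
    using assms by (intro product_partition) (auto simp: pairings_def intro: card_ge_0_finite)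
  then show ?thesis using assms by (simp add: pairings_def)
qed

lemma pairing_sum_nonneg: "(\<And>p. p \<subseteq> S \<Longrightarrow> 0 \<le> g p) \<Longrightarrow> 0 \<le> pairing_sum g S"
  unfolding pairing_sum_def
  by (intro sum_nonneg prod_nonneg) (auto simp: pairings_def partition_on_def)

lemma pairing_sum_empty: "pairing_sum g ({} :: 'a set) = 1"
proof -
  have "pairings ({} :: 'a set) = {{}}" by (auto simp: pairings_def partition_on_empty)
  then show ?thesis by (simp add: pairing_sum_def)
qed

lemma pairing_sum_card_2:
  assumes "card S = 2"
  shows "pairing_sum g S = g S"
proof -
  have fin: "finite S" "S \<noteq> {}" using assms by (auto intro: card_ge_0_finite)
  have "\<pi> = {S}" if "\<pi> \<in> pairings S" for \<pi>
  proof -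
    have "card \<pi> = 1" using card_pairing[OF fin(1) that] assms by simp
    then obtain p where "\<pi> = {p}" by (auto simp: card_1_singleton_iff)
    then show ?thesis using that by (auto simp: pairings_def partition_on_def)
  qed
  moreover have "{S} \<in> pairings S" using assms partition_on_space[OF fin(2)] by (simp add: pairings_def)
  ultimately have "pairings S = {{S}}" by blast
  then show ?thesis by (simp add: pairing_sum_def)
qed

lemma pairings_iff: "\<pi> \<in> pairings S \<longleftrightarrow> \<Union>\<pi> = S \<and> disjoint \<pi> \<and> (\<forall>p\<in>\<pi>. card p = 2)"
  by (auto simp: pairings_def partition_on_def)

lemma pairing_subset:
  assumes "\<pi> \<in> pairings S" "\<rho> \<subseteq> \<pi>"
  shows "\<rho> \<in> pairings (\<Union>\<rho>)" "\<pi> - \<rho> \<in> pairings (S - \<Union>\<rho>)" "\<Union>\<rho> \<subseteq> S"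
proof -
  have S: "\<Union>\<pi> = S" and d: "disjoint \<pi>" and c: "\<forall>p\<in>\<pi>. card p = 2"
    using assms(1) by (simp_all add: pairings_iff)
  have d': "disjoint \<rho>" "disjoint (\<pi> - \<rho>)" using pairwise_subset[OF d] assms(2) by auto
  then show "\<rho> \<in> pairings (\<Union>\<rho>)" using c assms(2) unfolding pairings_iff by blast
  show "\<Union>\<rho> \<subseteq> S" using S assms(2) by blast
  have "p \<inter> p' = {}" if "p \<in> \<rho>" "p' \<in> \<pi> - \<rho>" for p p'
    using disjointD[OF d, of p p'] that assms(2) by blast
  then have "\<Union>(\<pi> - \<rho>) = S - \<Union>\<rho>" using S assms(2) by blast
  then show "\<pi> - \<rho> \<in> pairings (S - \<Union>\<rho>)" using c d' unfolding pairings_iff by blast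
qed

lemma pairing_union:
  assumes "C \<subseteq> S" "\<rho> \<in> pairings C" "\<rho>' \<in> pairings (S - C)"
  shows "\<rho> \<union> \<rho>' \<in> pairings S" "\<Union>\<rho> = C" "(\<rho> \<union> \<rho>') - \<rho> = \<rho>'" "\<rho> \<inter> \<rho>' = {}"
proof -
  have u: "\<Union>\<rho> = C" "\<Union>\<rho>' = S - C" and d: "disjoint \<rho>" "disjoint \<rho>'" and e: "{} \<notin> \<rho>" "{} \<notin> \<rho>'"
    and c: "\<forall>p\<in>\<rho> \<union> \<rho>'. card p = 2"
    using assms by (auto simp: pairings_def partition_on_def)
  show "\<Union>\<rho> = C" by (rule u)
  have cross: "p \<inter> p' = {}" if "p \<in> \<rho>" "p' \<in> \<rho>'" for p p'
    using that u by blast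
  have "disjoint (\<rho> \<union> \<rho>')" using d cross unfolding disjoint_def by blast
  then show "\<rho> \<union> \<rho>' \<in> pairings S"
    using assms(1) u e c by (auto simp: pairings_def partition_on_def)
  show "\<rho> \<inter> \<rho>' = {}" using cross e by fastforce
  then show "(\<rho> \<union> \<rho>') - \<rho> = \<rho>'" by blast
qed

text \<open>Pairings of \<open>C\<close> and \<open>S - C\<close> amount to a pairing of
  \<open>S\<close> with some pairs marked, \<open>C\<close> being the union of the marked ones. Each
  pair is marked or not, hence the factor 2.\<close>

lemma pairing_sum_convolution:
  assumes "finite S"
  shows "(\<Sum>C\<in>Pow S. pairing_sum g C * pairing_sum g (S - C)) = pairing_sum (\<lambda>p. 2 * g p) S"
proof -
  have fin: "finite C" if "C \<subseteq> S" for C using assms that finite_subset by blast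
  have "(\<Sum>C\<in>Pow S. pairing_sum g C * pairing_sum g (S - C))
      = (\<Sum>C\<in>Pow S. \<Sum>(\<rho>, \<rho>')\<in>pairings C \<times> pairings (S - C). prod g \<rho> * prod g \<rho>')"
    by (simp add: pairing_sum_def sum_product sum.cartesian_product)
  also have "\<dots> = (\<Sum>(C, \<rho>, \<rho>')\<in>(SIGMA C:Pow S. pairings C \<times> pairings (S - C)). prod g \<rho> * prod g \<rho>')"
    using assms by (subst sum.Sigma) (auto intro!: finite_cartesian_product finite_pairings fin simp: case_prod_unfold)
  also have "\<dots> = (\<Sum>(\<pi>, \<rho>)\<in>(SIGMA \<pi>:pairings S. Pow \<pi>). prod g \<rho> * prod g (\<pi> - \<rho>))"
    by (rule sum.reindex_bij_witness[of _ "\<lambda>(\<pi>, \<rho>). (\<Union>\<rho>, \<rho>, \<pi> - \<rho>)" "\<lambda>(C, \<rho>, \<rho>'). (\<rho> \<union> \<rho>', \<rho>)"])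
      (auto simp: pairing_subset pairing_union dest: pairing_subset(3) pairing_union(4))
  also have "\<dots> = (\<Sum>\<pi>\<in>pairings S. \<Sum>\<rho>\<in>Pow \<pi>. prod g \<rho> * prod g (\<pi> - \<rho>))"
    using assms by (subst sum.Sigma) (auto simp: finite_pairings dest: finite_pairing)
  also have "\<dots> = (\<Sum>\<pi>\<in>pairings S. \<Prod>p\<in>\<pi>. g p + g p)"
    using assms by (intro sum.cong refl prod_add[symmetric]) (auto dest: finite_pairing)
  finally show ?thesis by (simp add: pairing_sum_def)
qed

text \<open>There are half as many pairs as points, so each pair receives a factor
  \<open>1 / 4\<close>.\<close>

lemma pairing_sum_scale:
  assumes "finite S"
  shows "(1 / 2) ^ card S * pairing_sum (\<lambda>p. 2 * g p) S = pairing_sum (\<lambda>p. g p / 2) S"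
  unfolding pairing_sum_def sum_distrib_left
proof (rule sum.cong[OF refl])
  fix \<pi> assume "\<pi> \<in> pairings S"
  then have "card S = 2 * card \<pi>" by (rule card_pairing[OF assms])
  then show "(1 / 2) ^ card S * (\<Prod>p\<in>\<pi>. 2 * g p) = (\<Prod>p\<in>\<pi>. g p / 2)"
    by (simp add: power_mult prod_dividef prod.distrib power_divide flip: power_mult_distrib)
      (simp add: field_simps flip: power_mult_distrib)
qed

lemma sum_Pow_split:
  fixes f :: "'a set \<Rightarrow> real"
  assumes "finite S" "S \<noteq> {}"
  shows "sum f (Pow S) = f {} + f S + sum f (Pow S - {{}, S})"
proof -
  have "sum f (Pow S) = sum f {{}, S} + sum f (Pow S - {{}, S})"
    using assms by (subst sum.union_disjoint[symmetric]) (auto intro!: sum.cong)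
  then show ?thesis using assms by simp
qed

text \<open>The hypotheses on \<open>G\<close> and \<open>k\<close> hold with equality for moments of a centred Gaussian vector
  of covariance \<open>G\<close> and of the same vector scaled by \<open>1 / sqrt 2\<close>.  The terms of full
  size contribute \<open>G S\<close> itself on the right-hand side, but only with a factor \<open>4 / 2 ^ card S\<close>.\<close>

lemma gaussian_bound:
  fixes G k :: "'a set \<Rightarrow> real"
  assumes "finite V"
    and G0: "G {} = 1" and G1: "\<And>v. v \<in> V \<Longrightarrow> G {v} = 0"
    and Gpos: "\<And>A. A \<subseteq> V \<Longrightarrow> 0 \<le> G A" and kpos: "\<And>A. A \<subseteq> V \<Longrightarrow> 0 \<le> k A"
    and G_le: "\<And>A. A \<subseteq> V \<Longrightarrow> A \<noteq> {} \<Longrightarrow> G A \<le> 2 * k A + (\<Sum>B\<in>Pow A - {{}, A}. k B * k (A - B))"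
    and k_le: "\<And>A. A \<subseteq> V \<Longrightarrow> k A \<le> (1 / 2) ^ card A * (\<Sum>C\<in>Pow A. G C * G (A - C))"
    and "S \<subseteq> V"
  shows "G S \<le> pairing_sum G S"
  using \<open>S \<subseteq> V\<close>
proof (induction "card S" arbitrary: S rule: less_induct)
  case less
  have fin: "finite S" using less.prems \<open>finite V\<close> finite_subset by blast
  let ?\<Gamma> = "pairing_sum G" and ?h = "pairing_sum (\<lambda>p. G p / 2)"
  \<comment> \<open>The factor \<open>4 * (1 / 2) ^ card S\<close> is below 1 only from cardinality
    3 on.\<close>
  consider "S = {}" | "card S = 1" | "card S = 2" | "3 \<le> card S"
    using fin by (cases "card S = 0") (force, linarith)
  then show ?case
  proof cases
    case 1
    then show ?thesis by (simp add: G0 pairing_sum_empty)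
  next
    case 2
    then obtain v where "S = {v}" by (auto simp: card_1_singleton_iff)
    then have "G S = 0" using G1 less.prems by auto
    then show ?thesis
      using pairing_sum_nonneg[of S G] Gpos less.prems by auto
  next
    case 3
    then show ?thesis by (simp add: pairing_sum_card_2)
  next
    case 4
    then have "S \<noteq> {}" by auto
    have sub: "C \<subseteq> V" if "C \<subseteq> S" for C using that less.prems by blast
    have IH: "G C \<le> ?\<Gamma> C" if "C \<subset> S" for C
      using that less.hyps[of C] psubset_card_mono[OF fin that] sub by auto
    have \<Gamma>pos: "0 \<le> ?\<Gamma> C" "0 \<le> ?h C" if "C \<subseteq> S" for C
      using subset_trans[OF _ sub[OF that]] by (simp_all add: pairing_sum_nonneg Gpos)
    have psub: "C \<subset> S \<and> S - C \<subset> S" if "C \<in> Pow S - {{}, S}" for C using that by auto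
    have k_le': "k A \<le> ?h A" if "A \<subset> S" for A
    proof -
      have "k A \<le> (1 / 2) ^ card A * (\<Sum>C\<in>Pow A. G C * G (A - C))"
        using that sub by (intro k_le) auto
      also have "\<dots> \<le> (1 / 2) ^ card A * (\<Sum>C\<in>Pow A. ?\<Gamma> C * ?\<Gamma> (A - C))"
        using that sub by (intro mult_left_mono sum_mono mult_mono IH Gpos \<Gamma>pos) auto
      also have "\<dots> = ?h A"
        using that fin pairing_sum_convolution[of A G] pairing_sum_scale[of A G] finite_subset[of A S] by auto
      finally show ?thesis .
    qed
    \<comment> \<open>Convolving \<open>?h\<close> with itself restores \<open>?\<Gamma>\<close>:
      doubling undoes the halved covariances.\<close>
    have 1: "(\<Sum>B\<in>Pow S - {{}, S}. k B * k (S - B)) \<le> ?\<Gamma> S - 2 * ?h S"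
    proof -
      have "(\<Sum>B\<in>Pow S - {{}, S}. k B * k (S - B)) \<le> (\<Sum>B\<in>Pow S - {{}, S}. ?h B * ?h (S - B))"
        using psub sub by (intro sum_mono mult_mono k_le' kpos \<Gamma>pos) auto
      also have "\<dots> = (\<Sum>B\<in>Pow S. ?h B * ?h (S - B)) - 2 * ?h S"
        using \<open>S \<noteq> {}\<close> fin by (simp add: sum_Pow_split pairing_sum_empty)
      also have "(\<Sum>B\<in>Pow S. ?h B * ?h (S - B)) = ?\<Gamma> S"
        by (subst pairing_sum_convolution[OF fin]) simp
      finally show ?thesis .
    qed
    \<comment> \<open>The terms \<open>C = {}\<close> and \<open>C = S\<close> contain
      \<open>G S\<close> itself, which the induction hypothesis does not bound; they are kept and
      yield the last summand.\<close>
    have 2: "k S \<le> ?h S + 2 * (1 / 2) ^ card S * (G S - ?\<Gamma> S)"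
    proof -
      have "(\<Sum>C\<in>Pow S. G C * G (S - C)) = 2 * G S + (\<Sum>C\<in>Pow S - {{}, S}. G C * G (S - C))"
        using \<open>S \<noteq> {}\<close> fin by (simp add: sum_Pow_split G0)
      also have "(\<Sum>C\<in>Pow S - {{}, S}. G C * G (S - C)) \<le> (\<Sum>C\<in>Pow S - {{}, S}. ?\<Gamma> C * ?\<Gamma> (S - C))"
        using psub sub by (intro sum_mono mult_mono IH Gpos \<Gamma>pos) auto
      also have "\<dots> = (\<Sum>C\<in>Pow S. ?\<Gamma> C * ?\<Gamma> (S - C)) - 2 * ?\<Gamma> S"
        using \<open>S \<noteq> {}\<close> fin by (simp add: sum_Pow_split pairing_sum_empty)
      also have "(\<Sum>C\<in>Pow S. ?\<Gamma> C * ?\<Gamma> (S - C)) = pairing_sum (\<lambda>p. 2 * G p) S"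
        by (rule pairing_sum_convolution[OF fin])
      finally have "(1 / 2) ^ card S * (\<Sum>C\<in>Pow S. G C * G (S - C))
          \<le> (1 / 2) ^ card S * (2 * G S + (pairing_sum (\<lambda>p. 2 * G p) S - 2 * ?\<Gamma> S))"
        by (intro mult_left_mono) auto
      also have "\<dots> = (1 / 2) ^ card S * pairing_sum (\<lambda>p. 2 * G p) S + 2 * (1 / 2) ^ card S * (G S - ?\<Gamma> S)"
        by (simp add: algebra_simps)
      finally show ?thesis
        unfolding pairing_sum_scale[OF fin] using k_le[OF less.prems] by linarith
    qed
    have "G S \<le> 2 * k S + (\<Sum>B\<in>Pow S - {{}, S}. k B * k (S - B))"
      by (rule G_le[OF less.prems \<open>S \<noteq> {}\<close>])
    then have "G S - ?\<Gamma> S \<le> 4 * (1 / 2) ^ card S * (G S - ?\<Gamma> S)" using 1 2 by simp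
    \<comment> \<open>The excess \<open>G S - ?\<Gamma> S\<close> is at most a multiple of itself
      with factor at most \<open>1 / 2\<close>, so it cannot be positive.\<close>
    then have le: "(1 - 4 * (1 / 2) ^ card S) * (G S - ?\<Gamma> S) \<le> 0" by (simp add: algebra_simps)
    have "(1 / 2 :: real) ^ card S \<le> (1 / 2) ^ 3" using 4 by (intro power_decreasing) auto
    then have "0 < 1 - 4 * (1 / 2 :: real) ^ card S" by (simp add: power3_eq_cube)
    with le show ?thesis by (simp add: mult_le_0_iff)
  qed
qed

subsection \<open>The Ashkin--Teller model\<close>

definition edge_c0 :: "real \<Rightarrow> real \<Rightarrow> real" where "edge_c0 J U = (exp (2 * U) * cosh (2 * J) + 1) / 2"
definition edge_c1 :: "real \<Rightarrow> real \<Rightarrow> real" where "edge_c1 J U = exp (2 * U) * sinh (2 * J) / 2"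
definition edge_c2 :: "real \<Rightarrow> real \<Rightarrow> real" where "edge_c2 J U = (exp (2 * U) * cosh (2 * J) - 1) / 2"

text \<open>The coefficients are fixed by the values \<open>exp (2 * U + 2 * J)\<close> and
  \<open>exp (2 * U - 2 * J)\<close> at equal signs and 1 at opposite signs.\<close>

lemma exp_eq_edge_poly:
  assumes "a \<in> {-1, 1}" "b \<in> {-1, 1}"
  shows "exp (J * (a + b) + U * (a * b + 1)) = edge_poly (edge_c0 J U) (edge_c1 J U) (edge_c2 J U) a b"
proof -
  have "exp (2 * J + 2 * U) = exp (2 * U) * (cosh (2 * J) + sinh (2 * J))"
    by (simp add: cosh_plus_sinh exp_add)
  moreover have "exp (2 * U - 2 * J) = exp (2 * U) * (cosh (2 * J) - sinh (2 * J))"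
    by (simp add: cosh_minus_sinh exp_diff exp_minus field_simps)
  ultimately show ?thesis
    using assms by (auto simp: edge_poly_def edge_c0_def edge_c1_def edge_c2_def field_simps)
qed

text \<open>\<open>edge_c2\<close> is nonnegative by the hyperbolic cosine hypothesis. The last
  inequality reduces, by the hyperbolic Pythagorean identity, to \<open>exp (2 * U)\<close> being at
  most 1.\<close>

lemma edge_coefficients:
  assumes "J \<ge> 0" "U \<le> 0" "cosh (2 * J) \<ge> exp (- 2 * U)"
  shows "0 \<le> edge_c1 J U" "0 \<le> edge_c2 J U" "edge_c2 J U \<le> edge_c0 J U"
    "2 * edge_c1 J U \<le> edge_c0 J U + edge_c2 J U" "edge_c0 J U * edge_c2 J U \<le> (edge_c1 J U)\<^sup>2"
proof -
  let ?C = "cosh (2 * J)" and ?D = "sinh (2 * J)"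
  show "0 \<le> edge_c1 J U" using assms by (simp add: edge_c1_def)
  have "exp (2 * U) * exp (- 2 * U) \<le> exp (2 * U) * ?C" using assms by (intro mult_left_mono) auto
  then show "0 \<le> edge_c2 J U" by (simp add: edge_c2_def flip: exp_add)
  show "edge_c2 J U \<le> edge_c0 J U" by (simp add: edge_c2_def edge_c0_def)
  have "?D \<le> ?C" using cosh_minus_sinh[of "2 * J"] exp_gt_zero[of "- (2 * J)"] by linarith
  then have "exp (2 * U) * ?D \<le> exp (2 * U) * ?C" by simp
  then show "2 * edge_c1 J U \<le> edge_c0 J U + edge_c2 J U"
    by (simp add: add_divide_distrib diff_divide_distrib edge_c0_def edge_c1_def edge_c2_def)
  have "(exp (2 * U))\<^sup>2 * (?C\<^sup>2 - ?D\<^sup>2) \<le> 1"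
    using assms by (simp add: cosh_square_eq power_le_one)
  then show "edge_c0 J U * edge_c2 J U \<le> (edge_c1 J U)\<^sup>2"
    by (simp add: edge_c0_def edge_c1_def edge_c2_def power2_eq_square algebra_simps)
qed

lemma spin_prod_in:
  assumes "\<sigma> \<in> spins V" "e \<subseteq> V"
  shows "spin_prod e \<sigma> \<in> {-1, 1}"
proof -
  have "\<bar>\<sigma> v\<bar> = 1" if "v \<in> e" for v
    using PiE_mem[of \<sigma> V "\<lambda>_. {-1, 1}" v] assms(1) subsetD[OF assms(2) that] by (auto simp: spins_def)
  then have "\<bar>spin_prod e \<sigma>\<bar> = 1"
    unfolding spin_prod_def abs_prod by simp
  then show ?thesis by auto
qed

section \<open>Expectations and symmetries of the model\<close>

locale AT_model =
  fixes V :: "'a set" and E :: "'a set set" and J U :: "'a set \<Rightarrow> real"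
  assumes finite_V: "finite V"
    and edges: "\<And>e. e \<in> E \<Longrightarrow> e \<subseteq> V \<and> card e = 2"
begin

abbreviation "expect \<equiv> AT_expectation V E J U"

abbreviation "W \<equiv> AT_weight E J U"

lemma finite_E: "finite E"
  using edges by (intro finite_subset[of E "Pow V"]) (auto simp: finite_V)

lemma Z_pos: "0 < (\<Sum>\<omega>\<in>confs V. W \<omega>)"
  using AT_partition_function_pos[OF finite_V] by (simp add: AT_partition_function_def)

lemma expect_eq: "expect f = (\<Sum>\<omega>\<in>confs V. W \<omega> * f \<omega>) / (\<Sum>\<omega>\<in>confs V. W \<omega>)"
  by (simp add: AT_expectation_eq_sum finite_V AT_partition_function_def sum_divide_distrib)

lemma expect_sum: "expect (\<lambda>\<omega>. \<Sum>i\<in>I. f i \<omega>) = (\<Sum>i\<in>I. expect (f i))"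
  unfolding expect_eq sum_distrib_left sum_divide_distrib by (rule sum.swap)

lemma expect_scale: "expect (\<lambda>\<omega>. c * f \<omega>) = c * expect f"
  unfolding expect_eq by (simp add: sum_distrib_left mult_ac)

lemma expect_one: "expect (\<lambda>_. 1) = 1"
  using Z_pos by (simp add: expect_eq)

lemma expect_swap: "expect (\<lambda>\<omega>. f (prod.swap \<omega>)) = expect f"
proof -
  have "(\<Sum>\<omega>\<in>confs V. W \<omega> * f (prod.swap \<omega>)) = (\<Sum>\<omega>\<in>confs V. W \<omega> * f \<omega>)"
    by (rule sum.reindex_bij_witness[of _ prod.swap prod.swap]) (auto simp: AT_weight_def add_ac mult_ac)
  then show ?thesis by (simp add: expect_eq)
qed

text \<open>Every edge has two endpoints, so flipping the whole second layer preserves all edge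
  products. The flip exchanges X and Y.\<close>

lemma expect_flip_snd: "expect (\<lambda>\<omega>. f (fst \<omega>, restrict (\<lambda>v. - snd \<omega> v) V)) = expect f"
proof -
  define n :: "('a \<Rightarrow> real) \<Rightarrow> 'a \<Rightarrow> real" where n_def: "n \<sigma> = restrict (\<lambda>v. - \<sigma> v) V" for \<sigma>
  let ?\<phi> = "\<lambda>\<omega>. (fst \<omega> :: 'a \<Rightarrow> real, n (snd \<omega>))"
  have n: "n \<sigma> \<in> spins V" "n (n \<sigma>) = \<sigma>" if "\<sigma> \<in> spins V" for \<sigma>
    using that by (auto simp: n_def spins_def PiE_iff extensional_def)
  have e: "spin_prod e (n \<sigma>) = spin_prod e \<sigma>" if "e \<in> E" for e \<sigma>
    using edges[OF that] by (auto simp: n_def card_2_iff spin_prod_def)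
  have W: "W (?\<phi> \<omega>) = W \<omega>" for \<omega>
    unfolding AT_weight_def by (auto simp: e split: prod.split intro!: prod.cong)
  have "(\<Sum>\<omega>\<in>confs V. W \<omega> * f (?\<phi> \<omega>)) = (\<Sum>\<omega>\<in>confs V. W \<omega> * f \<omega>)"
    by (rule sum.reindex_bij_witness[of _ ?\<phi> ?\<phi>]) (auto simp: n W)
  then show ?thesis by (simp add: expect_eq n_def)
qed

end

section \<open>Correlation inequalities and their combination\<close>

locale AT_antiferro = AT_model +
  assumes J: "\<And>e. e \<in> E \<Longrightarrow> J e \<ge> 0"
    and U: "\<And>e. e \<in> E \<Longrightarrow> U e \<le> 0"
    and JU: "\<And>e. e \<in> E \<Longrightarrow> cosh (2 * J e) \<ge> exp (- 2 * U e)"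
begin

text \<open>The weight of two copies is a product over edges, and the cone is closed under products,
  so one edge suffices.\<close>

lemma weight_cone:
  assumes "site_cone B"
    and B: "\<And>c0 c1 c2 u v. 0 \<le> c1 \<Longrightarrow> 0 \<le> c2 \<Longrightarrow> c2 \<le> c0 \<Longrightarrow> 2 * c1 \<le> c0 + c2 \<Longrightarrow> c0 * c2 \<le> c1\<^sup>2 \<Longrightarrow>
      u \<in> V \<Longrightarrow> v \<in> V \<Longrightarrow>
      site_cone.cone B V (\<lambda>\<omega> \<omega>'. edge_val c0 c1 c2 (site \<omega> u) (site \<omega> v) * edge_val c0 c1 c2 (site \<omega>' u) (site \<omega>' v))"
  shows "site_cone.cone B V (\<lambda>\<omega> \<omega>'. W \<omega> * W \<omega>')"
proof -
  interpret site_cone B by fact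
  let ?f = "\<lambda>e \<omega>. exp (J e * (spin_prod e (fst \<omega>) + spin_prod e (snd \<omega>))
    + U e * (spin_prod e (fst \<omega>) * spin_prod e (snd \<omega>) + 1))"
  have "cone V (\<lambda>\<omega> \<omega>'. ?f e \<omega> * ?f e \<omega>')" if e: "e \<in> E" for e
  proof -
    obtain u v where uv: "e = {u, v}" "u \<noteq> v" "u \<in> V" "v \<in> V"
      using edges[OF e] by (auto simp: card_2_iff)
    let ?c = "edge_val (edge_c0 (J e) (U e)) (edge_c1 (J e) (U e)) (edge_c2 (J e) (U e))"
    have f: "?f e \<omega> = ?c (site \<omega> u) (site \<omega> v)" if "\<omega> \<in> confs V" for \<omega>
    proof -
      have "?f e \<omega> = edge_poly (edge_c0 (J e) (U e)) (edge_c1 (J e) (U e)) (edge_c2 (J e) (U e))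
          (spin_prod e (fst \<omega>)) (spin_prod e (snd \<omega>))"
        using that edges[OF e] by (intro exp_eq_edge_poly spin_prod_in) auto
      then show ?thesis unfolding uv(1) spin_prod_doubleton[OF uv(2)] by (simp add: edge_val_def site_def)
    qed
    show ?thesis
      using B[OF edge_coefficients[OF J[OF e] U[OF e] JU[OF e]] uv(3,4)]
      by (rule eq_on_confs) (simp add: f)
  qed
  note cone_prod[OF finite_E this]
  moreover have "W \<omega> = (\<Prod>e\<in>E. ?f e \<omega>)" for \<omega>
    by (cases \<omega>) (simp add: AT_weight_def)
  ultimately show ?thesis
    by (simp only: prod.distrib)
qed

lemma expect_le_of_cone:
  assumes "site_cone B" and W: "site_cone.cone B V (\<lambda>\<omega> \<omega>'. W \<omega> * W \<omega>')"
    and f: "(\<lambda>x y. (f x + f y) / 2) \<in> B" "(\<lambda>x y. (f x - f y) / 2) \<in> B"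
    and g: "(\<lambda>x y. (g y + g x) / 2) \<in> B" "(\<lambda>x y. (g y - g x) / 2) \<in> B"
    and sub: "A \<subseteq> V" "D \<subseteq> V"
  shows "0 \<le> expect (\<lambda>\<omega>. \<Prod>v\<in>A. f (site \<omega> v))"
    and "expect (\<lambda>\<omega>. (\<Prod>v\<in>A. f (site \<omega> v)) * (\<Prod>v\<in>D. g (site \<omega> v)))
      \<le> expect (\<lambda>\<omega>. \<Prod>v\<in>A. f (site \<omega> v)) * expect (\<lambda>\<omega>. \<Prod>v\<in>D. g (site \<omega> v))"
proof -
  interpret site_cone B by fact
  note * = finite_V sub W f g
  show "0 \<le> expect (\<lambda>\<omega>. \<Prod>v\<in>A. f (site \<omega> v))"
    using sum_W_nonneg[OF *] Z_pos by (simp add: expect_eq zero_le_mult_iff)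
  show "expect (\<lambda>\<omega>. (\<Prod>v\<in>A. f (site \<omega> v)) * (\<Prod>v\<in>D. g (site \<omega> v)))
      \<le> expect (\<lambda>\<omega>. \<Prod>v\<in>A. f (site \<omega> v)) * expect (\<lambda>\<omega>. \<Prod>v\<in>D. g (site \<omega> v))"
    using sum_W_le[OF *] Z_pos by (simp add: expect_eq divide_simps mult_ac)
qed

definition spin_corr where "spin_corr A = expect (\<lambda>\<omega>. \<Prod>v\<in>A. fst (site \<omega> v))"
definition rot_corr where "rot_corr A = expect (\<lambda>\<omega>. \<Prod>v\<in>A. (fst (site \<omega> v) + snd (site \<omega> v)) / 2)"

lemma expect_snd: "expect (\<lambda>\<omega>. \<Prod>v\<in>A. snd (site \<omega> v)) = spin_corr A"
  using expect_swap[of "\<lambda>\<omega>. \<Prod>v\<in>A. fst (site \<omega> v)"] by (simp add: spin_corr_def site_def)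

lemma expect_diff: "A \<subseteq> V \<Longrightarrow> expect (\<lambda>\<omega>. \<Prod>v\<in>A. (fst (site \<omega> v) - snd (site \<omega> v)) / 2) = rot_corr A"
  using expect_flip_snd[of "\<lambda>\<omega>. \<Prod>v\<in>A. (fst (site \<omega> v) + snd (site \<omega> v)) / 2"]
  by (simp add: rot_corr_def site_def subset_iff cong: prod.cong)

lemma spin_corr_single: "v \<in> V \<Longrightarrow> spin_corr {v} = 0"
  using expect_flip_snd[of "\<lambda>\<omega>. snd \<omega> v"] expect_snd[of "{v}"] expect_scale[of "-1" "\<lambda>\<omega>. snd \<omega> v"]
  by (simp add: site_def)

lemma
  assumes "A \<subseteq> V" "D \<subseteq> V"
  shows spin_corr_nonneg: "0 \<le> spin_corr A"
    and expect_fst_snd_le: "expect (\<lambda>\<omega>. (\<Prod>v\<in>A. fst (site \<omega> v)) * (\<Prod>v\<in>D. snd (site \<omega> v))) \<le> spin_corr A * spin_corr D"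
proof -
  \<comment> \<open>Each function is a free sign times the indicator that the copies agree or
    disagree in that layer.\<close>
  have B: "(\<lambda>p q. (fst p + fst q) / 2) \<in> layer_family" "(\<lambda>p q. (fst p - fst q) / 2) \<in> layer_family"
    "(\<lambda>p q. (snd q + snd p) / 2) \<in> layer_family" "(\<lambda>p q. (snd q - snd p) / 2) \<in> layer_family"
    by (rule layer_familyI[of "\<lambda>s t. of_bool (s = 1)" _ 1 0] layer_familyI[of "\<lambda>s t. of_bool (s = -1)" _ 1 0]
      layer_familyI[of "\<lambda>s t. of_bool (t = 1)" _ 0 1] layer_familyI[of "\<lambda>s t. of_bool (t = -1)" _ 0 1];
      force simp: states_eq)+
  note * = expect_le_of_cone[OF layer.site_cone_axioms weight_cone[OF layer.site_cone_axioms] B assms]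
  show "0 \<le> spin_corr A" unfolding spin_corr_def by (rule *(1)) (rule layer_edge_cone; simp add: finite_V)
  show "expect (\<lambda>\<omega>. (\<Prod>v\<in>A. fst (site \<omega> v)) * (\<Prod>v\<in>D. snd (site \<omega> v))) \<le> spin_corr A * spin_corr D"
    unfolding expect_snd[symmetric, of D] spin_corr_def[of A] by (rule *(2)) (rule layer_edge_cone; simp add: finite_V)
qed

lemma
  assumes "A \<subseteq> V" "D \<subseteq> V"
  shows rot_corr_nonneg: "0 \<le> rot_corr A"
    and expect_sum_diff_le: "expect (\<lambda>\<omega>. (\<Prod>v\<in>A. (fst (site \<omega> v) + snd (site \<omega> v)) / 2)
      * (\<Prod>v\<in>D. (fst (site \<omega> v) - snd (site \<omega> v)) / 2)) \<le> rot_corr A * rot_corr D"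
proof -
  let ?f = "\<lambda>p :: real \<times> real. (fst p + snd p) / 2" and ?g = "\<lambda>p :: real \<times> real. (fst p - snd p) / 2"
  \<comment> \<open>In a nonaligned pair exactly one copy of X and one of Y is nonzero, whence
    \<open>1 / 2\<close>; the differences also carry \<open>fst p * snd p\<close>, which tells which
    copy it is.\<close>
  have "(\<lambda>p q. (?f p + ?f q) / 2) \<in> rotated_family"
    by (rule rotated_familyI[of "\<lambda>t s. of_bool (t = 1 \<and> s = 1)" "1 / 2" _ 1 0 1 0])
      (simp, simp, (elim states_cases; simp add: state_pair_simps)+)
  moreover have "(\<lambda>p q. (?f p - ?f q) / 2) \<in> rotated_family"
    by (rule rotated_familyI[of "\<lambda>t s. of_bool (t = 1 \<and> s = -1)" "1 / 2" _ 1 1 1 0])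
      (simp, simp, (elim states_cases; simp add: state_pair_simps)+)
  moreover have "(\<lambda>p q. (?g q + ?g p) / 2) \<in> rotated_family"
    by (rule rotated_familyI[of "\<lambda>t s. of_bool (t = -1 \<and> s = 1)" "1 / 2" _ 1 0 0 1])
      (simp, simp, (elim states_cases; simp add: state_pair_simps)+)
  moreover have "(\<lambda>p q. (?g q - ?g p) / 2) \<in> rotated_family"
    by (rule rotated_familyI[of "\<lambda>t s. of_bool (t = -1 \<and> s = -1)" "1 / 2" _ 1 1 0 1])
      (simp, simp, (elim states_cases; simp add: state_pair_simps)+)
  ultimately have B: "(\<lambda>p q. (?f p + ?f q) / 2) \<in> rotated_family" "(\<lambda>p q. (?f p - ?f q) / 2) \<in> rotated_family"
    "(\<lambda>p q. (?g q + ?g p) / 2) \<in> rotated_family" "(\<lambda>p q. (?g q - ?g p) / 2) \<in> rotated_family" by blast+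
  note * = expect_le_of_cone[OF rotated.site_cone_axioms weight_cone[OF rotated.site_cone_axioms] B assms]
  show "0 \<le> rot_corr A" unfolding rot_corr_def by (rule *(1)) (rule rotated_edge_cone; simp add: finite_V)
  show "expect (\<lambda>\<omega>. (\<Prod>v\<in>A. ?f (site \<omega> v)) * (\<Prod>v\<in>D. ?g (site \<omega> v))) \<le> rot_corr A * rot_corr D"
    unfolding expect_diff[symmetric, OF assms(2)] rot_corr_def[of A] by (rule *(2)) (rule rotated_edge_cone; simp add: finite_V)
qed

text \<open>The terms \<open>B = {}\<close> and \<open>B = A\<close> both equal
  \<open>rot_corr A\<close>, the first by the flip symmetry.\<close>

lemma spin_corr_le:
  assumes "A \<subseteq> V" "A \<noteq> {}"
  shows "spin_corr A \<le> 2 * rot_corr A + (\<Sum>B\<in>Pow A - {{}, A}. rot_corr B * rot_corr (A - B))"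
proof -
  have fin: "finite A" using assms finite_V finite_subset by blast
  let ?f = "\<lambda>p :: real \<times> real. (fst p + snd p) / 2" and ?g = "\<lambda>p :: real \<times> real. (fst p - snd p) / 2"
  let ?K = "\<lambda>B. expect (\<lambda>\<omega>. (\<Prod>v\<in>B. ?f (site \<omega> v)) * (\<Prod>v\<in>A - B. ?g (site \<omega> v)))"
  have "spin_corr A = expect (\<lambda>\<omega>. \<Prod>v\<in>A. ?f (site \<omega> v) + ?g (site \<omega> v))"
    unfolding spin_corr_def by (simp add: field_simps)
  also have "\<dots> = (\<Sum>B\<in>Pow A. ?K B)"
    by (simp only: prod_add[OF fin] expect_sum)
  also have "\<dots> = 2 * rot_corr A + (\<Sum>B\<in>Pow A - {{}, A}. ?K B)"
    using assms(1) by (subst sum_Pow_split[OF fin assms(2)]) (simp add: expect_diff flip: rot_corr_def)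
  also have "(\<Sum>B\<in>Pow A - {{}, A}. ?K B) \<le> (\<Sum>B\<in>Pow A - {{}, A}. rot_corr B * rot_corr (A - B))"
    using assms by (intro sum_mono expect_sum_diff_le) auto
  finally show ?thesis by simp
qed

lemma rot_corr_le:
  assumes "A \<subseteq> V"
  shows "rot_corr A \<le> (1 / 2) ^ card A * (\<Sum>C\<in>Pow A. spin_corr C * spin_corr (A - C))"
proof -
  have fin: "finite A" using assms finite_V finite_subset by blast
  have "rot_corr A = expect (\<lambda>\<omega>. (1 / 2) ^ card A * (\<Prod>v\<in>A. fst (site \<omega> v) + snd (site \<omega> v)))"
    unfolding rot_corr_def by (simp add: prod_dividef power_divide)
  also have "\<dots> = (1 / 2) ^ card A *
      (\<Sum>C\<in>Pow A. expect (\<lambda>\<omega>. (\<Prod>v\<in>C. fst (site \<omega> v)) * (\<Prod>v\<in>A - C. snd (site \<omega> v))))"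
    by (simp only: expect_scale prod_add[OF fin] expect_sum)
  also have "\<dots> \<le> (1 / 2) ^ card A * (\<Sum>C\<in>Pow A. spin_corr C * spin_corr (A - C))"
    using assms by (intro mult_left_mono sum_mono expect_fst_snd_le) auto
  finally show ?thesis .
qed

lemma spin_corr_le_pairing_sum: "S \<subseteq> V \<Longrightarrow> spin_corr S \<le> pairing_sum spin_corr S"
  by (rule gaussian_bound[OF finite_V _ spin_corr_single spin_corr_nonneg rot_corr_nonneg spin_corr_le rot_corr_le])
    (auto simp: spin_corr_def expect_one)

end

theorem proposition20:
  fixes V :: "'a set" and E :: "'a set set" and J U :: "'a set \<Rightarrow> real" and S :: "'a set"
  assumes "finite V"
    and "\<And>e. e \<in> E \<Longrightarrow> e \<subseteq> V \<and> card e = 2"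
    and "\<And>e. e \<in> E \<Longrightarrow> J e \<ge> 0"
    and "\<And>e. e \<in> E \<Longrightarrow> U e \<le> 0"
    and "\<And>e. e \<in> E \<Longrightarrow> cosh (2 * J e) \<ge> exp (- 2 * U e)"
    and "S \<subseteq> V"
    and "even (card S)"
  shows "AT_expectation V E J U (\<lambda>(\<sigma>, \<tau>). spin_prod S \<sigma>)
    \<le> (\<Sum>\<pi>\<in>pairings S. \<Prod>p\<in>\<pi>. AT_expectation V E J U (\<lambda>(\<sigma>, \<tau>). spin_prod p \<sigma>))"
proof -
  interpret AT_antiferro V E J U
    by unfold_locales (use assms in auto)
  show ?thesis
    using spin_corr_le_pairing_sum[OF \<open>S \<subseteq> V\<close>]
    by (simp add: spin_corr_def pairing_sum_def site_def spin_prod_def case_prod_unfold)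
qed

end
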